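(* Let $\widehat E=E+\varepsilon E_0$ and $\widehat F=F+\varepsilon F_0$ be elements of $\mathbb{D}_n^{\rm CM}$, and let $r_e=\mathrm{rk}(E)$, $r_f=\mathrm{rk}(F)$. Then $\widehat E\overset{\rm D}{\leq}\widehat F$ (Dual-minus partial order) if and only if there is a nonsingular matrix $P\in\mathbb{R}^{n\times n}$ such that $$\widehat E=P\begin{pmatrix} D_1 & O & O \\ O & O & O \\ O & O & O \end{pmatrix}P^{-1}+\varepsilon P\begin{pmatrix} E_1 & E_2 & E_3 \\ E_4 & O & O \\ E_7 & O & O \end{pmatrix}P^{-1},$$ $$\widehat F=P\begin{pmatrix} D_1+RD_2S & RD_2 & O \\ D_2S & D_2 & O \\ O & O & O \end{pmatrix}P^{-1}+\varepsilon P\begin{pmatrix} E_1+RM+NS-RF_5S & N+E_2 & E_3+RF_6 \\ M+E_4 & F_5 & F_6 \\ E_7+F_8S & F_8 & O \end{pmatrix}P^{-1},$$ where $D_1\in\mathbb{R}^{r_e\times r_e}$ and $D_2\in\mathbb{R}^{(r_f-r_e)\times(r_f-r_e)}$ are invertible, $M,S\in\mathbb{R}^{(r_f-r_e)\times r_e}$ and $N,R\in\mathbb{R}^{r_e\times(r_f-r_e)}$ are some suitable matrices, and $E_1,E_2,E_3,E_4,E_7,F_5,F_6,F_8$ are real matrices of conformable sizes.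
   Context: $\varepsilon$ is the dual unit: $\varepsilon\neq 0$, $\varepsilon^2=0$, commuting with reals. $\mathbb{D}^{m\times n}$ is the set of $m\times n$ dual matrices $\widehat E=E+\varepsilon E_0$ with $E,E_0\in\mathbb{R}^{m\times n}$, with the obvious addition, multiplication and transpose $\widehat E^{T}=E^T+\varepsilon E_0^T$. The dual Moore-Penrose generalized inverse (DMPGI) of $\widehat E\in\mathbb{D}^{m\times n}$ is the unique $\widehat X\in\mathbb{D}^{n\times m}$, if it exists, with $\widehat E\widehat X\widehat E=\widehat E$, $\widehat X\widehat E\widehat X=\widehat X$, $(\widehat E\widehat X)^T=\widehat E\widehat X$, $(\widehat X\widehat E)^T=\widehat X\widehat E$. The dual group generalized inverse (DGGI) $\widehat E^{\#}$ of $\widehat E\in\mathbb{D}^{n\times n}$ is the $\widehat X\in\mathbb{D}^{n\times n}$, if it exists, with $\widehat E\widehat X\widehat E=\widehat E$, $\widehat X\widehat E\widehat X=\widehat X$, $\widehat E\widehat X=\widehat X\widehat E$. $\mathbb{D}_n^{\rm CM}$ is the set of dual matrices in $\mathbb{D}^{n\times n}$ of dual index one, i.e. (equivalently) those whose DGGI exists; every matrix in $\mathbb{D}_n^{\rm CM}$ has a DMPGI. Minus partial order on real matrices of the same size: $E\leq F$ means $\mathrm{rk}(F-E)=\mathrm{rk}(F)-\mathrm{rk}(E)$. Dual-minus partial order: for dual matrices $\widehat E,\widehat F$ of the same size whose DMPGIs exist, $\widehat E\overset{\rm D}{\leq}\widehat F$ means that $E\leq F$ and the DMPGI of $\widehat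 F-\widehat E$ exists. All $3\times3$ block matrices are partitioned with block-row and block-column sizes $r_e,\ r_f-r_e,\ n-r_f$; $O$ denotes zero blocks, and blocks of size zero are allowed. *)

theory Defs
  imports "Jordan_Normal_Form.DL_Rank"
begin

section \<open>Dual numbers\<close>

text \<open>The value \<open>Dual a b\<close> stands for \<open>a + b\<epsilon>\<close> with \<open>\<epsilon>\<^sup>2 = 0\<close>.\<close>

datatype dual = Dual (std_part: real) (dual_part: real)

instantiation dual :: comm_ring_1
begin

definition "0 = Dual 0 0"
definition "1 = Dual 1 0"
definition "x + y = Dual (std_part x + std_part y) (dual_part x + dual_part y)"
definition "x - y = Dual (std_part x - std_part y) (dual_part x - dual_part y)"
definition "- x = Dual (- std_part x) (- dual_part x)"
definition "x * y =
  Dual (std_part x * std_part y) (std_part x * dual_part y + dual_part x * std_part y)"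

instance
  by standard
    (auto simp: zero_dual_def one_dual_def plus_dual_def minus_dual_def uminus_dual_def
      times_dual_def algebra_simps)

end

definition dual_of_real :: "real \<Rightarrow> dual" where
  "dual_of_real a = Dual a 0"

definition dual_unit :: dual ("\<epsilon>") where
  "\<epsilon> = Dual 0 1"

lemma dual_unit_nonzero: "\<epsilon> \<noteq> 0"
  by (simp add: dual_unit_def zero_dual_def)

lemma dual_unit_square: "\<epsilon> * \<epsilon> = 0"
  by (simp add: dual_unit_def times_dual_def zero_dual_def)

lemma Dual_conv: "Dual a b = dual_of_real a + \<epsilon> * dual_of_real b"
  by (simp add: dual_of_real_def dual_unit_def times_dual_def plus_dual_def)


section \<open>Dual matrices\<close>

definition dual_mat :: "real mat \<Rightarrow> real mat \<Rightarrow> dual mat" where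
  "dual_mat A A\<^sub>0 = map_mat dual_of_real A + \<epsilon> \<cdot>\<^sub>m map_mat dual_of_real A\<^sub>0"

definition std_mat :: "dual mat \<Rightarrow> real mat" where
  "std_mat A = map_mat std_part A"

lemma dual_mat_carrier:
  "A\<^sub>0 \<in> carrier_mat m n \<Longrightarrow> dual_mat A A\<^sub>0 \<in> carrier_mat m n"
  by (simp add: dual_mat_def)

lemma std_mat_dual_mat:
  assumes "A \<in> carrier_mat m n" "A\<^sub>0 \<in> carrier_mat m n"
  shows "std_mat (dual_mat A A\<^sub>0) = A"
  using assms
  by (intro eq_matI) (auto simp: std_mat_def dual_mat_def dual_of_real_def dual_unit_def
      plus_dual_def times_dual_def)

text \<open>\<open>X\<close> is the dual Moore-Penrose (below: dual group) generalized inverse of \<open>A\<close>. The equations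
  determine \<open>X\<close> uniquely, so existence is stated without uniqueness.\<close>

definition is_dmpgi :: "dual mat \<Rightarrow> dual mat \<Rightarrow> bool" where
  "is_dmpgi A X \<longleftrightarrow> X \<in> carrier_mat (dim_col A) (dim_row A) \<and>
     A * X * A = A \<and> X * A * X = X \<and>
     (A * X)\<^sup>T = A * X \<and> (X * A)\<^sup>T = X * A"

definition has_dmpgi :: "dual mat \<Rightarrow> bool" where
  "has_dmpgi A \<longleftrightarrow> (\<exists>X. is_dmpgi A X)"

definition is_dggi :: "dual mat \<Rightarrow> dual mat \<Rightarrow> bool" where
  "is_dggi A X \<longleftrightarrow> X \<in> carrier_mat (dim_col A) (dim_row A) \<and>
     A * X * A = A \<and> X * A * X = X \<and> A * X = X * A"

definition has_dggi :: "dual mat \<Rightarrow> bool" where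
  "has_dggi A \<longleftrightarrow> (\<exists>X. is_dggi A X)"

text \<open>The square dual matrices of dual index one, characterised by existence of the
  dual group generalized inverse.\<close>

definition dual_CM :: "nat \<Rightarrow> dual mat set" where
  "dual_CM n = {A \<in> carrier_mat n n. has_dggi A}"


section \<open>Minus and dual-minus partial orders\<close>

definition mat_rank :: "real mat \<Rightarrow> nat" where
  "mat_rank A = vec_space.rank (dim_row A) A"

text \<open>The ranks are compared as integers, so that the subtraction is not truncated.\<close>

definition minus_le :: "real mat \<Rightarrow> real mat \<Rightarrow> bool" where
  "minus_le A B \<longleftrightarrow> dim_row A = dim_row B \<and> dim_col A = dim_col B \<and>
     int (mat_rank (B - A)) = int (mat_rank B) - int (mat_rank A)"

text \<open>A relation on dual matrices that have a dual Moore-Penrose inverse; this domain condition is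
  part of the definition.\<close>

definition dual_minus_le :: "dual mat \<Rightarrow> dual mat \<Rightarrow> bool" where
  "dual_minus_le A B \<longleftrightarrow> dim_row A = dim_row B \<and> dim_col A = dim_col B \<and>
     has_dmpgi A \<and> has_dmpgi B \<and>
     minus_le (std_mat A) (std_mat B) \<and> has_dmpgi (B - A)"


section \<open>Block matrices\<close>

text \<open>Horizontal counterpart of \<open>append_rows\<close>; as there, empty blocks are allowed.\<close>

definition append_cols :: "'a :: zero mat \<Rightarrow> 'a mat \<Rightarrow> 'a mat" where
  "append_cols A B = four_block_mat A B (0\<^sub>m 0 (dim_col A)) (0\<^sub>m 0 (dim_col B))"

definition block3 ::
  "'a :: zero mat \<Rightarrow> 'a mat \<Rightarrow> 'a mat \<Rightarrow>
   'a mat \<Rightarrow> 'a mat \<Rightarrow> 'a mat \<Rightarrow>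
   'a mat \<Rightarrow> 'a mat \<Rightarrow> 'a mat \<Rightarrow> 'a mat" where
  "block3 A11 A12 A13 A21 A22 A23 A31 A32 A33 =
     append_cols A11 (append_cols A12 A13) @\<^sub>r
     (append_cols A21 (append_cols A22 A23) @\<^sub>r
      append_cols A31 (append_cols A32 A33))"

lemma append_cols_carrier:
  "A \<in> carrier_mat m k \<Longrightarrow> B \<in> carrier_mat m l \<Longrightarrow> append_cols A B \<in> carrier_mat m (k + l)"
  unfolding append_cols_def
  by (rule carrier_matI) (auto dest: carrier_matD)

lemma block3_carrier:
  assumes "A11 \<in> carrier_mat a a" "A12 \<in> carrier_mat a b" "A13 \<in> carrier_mat a c"
    and "A21 \<in> carrier_mat b a" "A22 \<in> carrier_mat b b" "A23 \<in> carrier_mat b c"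
    and "A31 \<in> carrier_mat c a" "A32 \<in> carrier_mat c b" "A33 \<in> carrier_mat c c"
  shows "block3 A11 A12 A13 A21 A22 A23 A31 A32 A33 \<in> carrier_mat (a + b + c) (a + b + c)"
  unfolding block3_def add.assoc
  by (intro carrier_append_rows append_cols_carrier assms)

end

theory Submission
  imports Defs
begin

text \<open>A dual matrix \<open>A + \<epsilon>A\<^sub>0\<close> is regular iff \<open>A\<^sub>0 = AZ + WA\<close> for some real \<open>Z\<close>, \<open>W\<close>; then it equals
  \<open>(1 + \<epsilon>W) A (1 + \<epsilon>Z)\<close>, so a full-rank factorization of \<open>A\<close> lifts to the dual numbers and yields the
  Moore-Penrose inverse. If \<open>E\<close>, \<open>F\<close> have group inverses \<open>X\<close>, \<open>Y\<close> and \<open>E \<le> F\<close>, then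
  \<open>XE\<close>, \<open>YF - XE\<close> and \<open>1 - YF\<close> are orthogonal idempotents summing to \<open>1\<close>. Their full-rank
  factorizations \<open>B\<^sub>i C\<^sub>i\<close> are the block columns of \<open>P\<close> and block rows of \<open>P\<inverse>\<close>, and the blocks of a matrix \<open>T\<close>
  are \<open>C\<^sub>i T B\<^sub>j\<close>. In this frame \<open>F - E = (B\<^sub>1R + B\<^sub>2) D\<^sub>2 (SC\<^sub>1 + C\<^sub>2)\<close>, and the shape of the dual parts
  says exactly that those of \<open>E\<close>, \<open>F\<close> and \<open>F - E\<close> satisfy the regularity condition.\<close>

section \<open>Full-rank factorizations\<close>

lemma mult_assoc_dim:
  fixes A B C :: "'a::semiring_0 mat"
  assumes "dim_col A = dim_row B" "dim_col B = dim_row C"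
  shows "A * B * C = A * (B * C)"
  using assms by (intro assoc_mult_mat) auto

lemma mult_add_dim:
  fixes A B C :: "'a::semiring_0 mat"
  assumes "dim_col A = dim_row B" "dim_row B = dim_row C" "dim_col B = dim_col C"
  shows "A * (B + C) = A * B + A * C"
  using assms by (intro mult_add_distrib_mat[where nc = "dim_col C"]) auto

lemma add_mult_dim:
  fixes A B C :: "'a::semiring_0 mat"
  assumes "dim_col A = dim_row C" "dim_row A = dim_row B" "dim_col A = dim_col B"
  shows "(A + B) * C = A * C + B * C"
  using assms by (intro add_mult_distrib_mat[where nc = "dim_col C"]) auto

lemma mult_diff_dim:
  fixes A B C :: "'a::ring mat"
  assumes "dim_col A = dim_row B" "dim_row B = dim_row C" "dim_col B = dim_col C"
  shows "A * (B - C) = A * B - A * C"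
  using assms by (intro mult_minus_distrib_mat[where nc = "dim_col C"]) auto

lemma diff_mult_dim:
  fixes A B C :: "'a::ring mat"
  assumes "dim_col A = dim_row C" "dim_row A = dim_row B" "dim_col A = dim_col B"
  shows "(A - B) * C = A * C - B * C"
  using assms by (intro minus_mult_distrib_mat[where nc = "dim_col C"]) auto

lemmas mult_distrib_dim = mult_add_dim add_mult_dim mult_diff_dim diff_mult_dim

text \<open>Products are kept nested to the right, where \<open>A * B\<close> no longer occurs as a
  subterm of \<open>A * (B * X)\<close>. This form lets a known product be rewritten there; the next
  lemma does the same for three factors.\<close>

lemma mult_eq_assoc_dim:
  fixes A B C X :: "'a::semiring_0 mat"
  assumes "A * B = C" "dim_col A = dim_row B" "dim_col B = dim_row X"
  shows "A * (B * X) = C * X"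
  using assms by (metis mult_assoc_dim)

lemma mult_eq_assoc3_dim:
  fixes A B C D X :: "'a::semiring_0 mat"
  assumes "A * (B * C) = D" "dim_col A = dim_row B" "dim_col B = dim_row C" "dim_col C = dim_row X"
  shows "A * (B * (C * X)) = D * X"
  using assms mult_assoc_dim[of A "B * C" X] mult_assoc_dim[of B C X] by simp

lemma one_mult_dim [simp]: "dim_row X = n \<Longrightarrow> 1\<^sub>m n * X = (X :: 'a::semiring_1 mat)"
  by (rule left_mult_one_mat') auto

lemma mult_one_dim [simp]: "dim_col X = n \<Longrightarrow> X * 1\<^sub>m n = (X :: 'a::semiring_1 mat)"
  by (rule right_mult_one_mat') auto

lemma zero_mult_dim [simp]:
  "dim_row X = n \<Longrightarrow> 0\<^sub>m m n * X = 0\<^sub>m m (dim_col (X :: 'a::semiring_0 mat))"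
  by (rule left_mult_zero_mat[where n = n]) auto

lemma mult_zero_dim [simp]:
  "dim_col X = n \<Longrightarrow> X * 0\<^sub>m n m = 0\<^sub>m (dim_row (X :: 'a::semiring_0 mat)) m"
  by (rule right_mult_zero_mat[where n = n]) auto

section \<open>Gram matrices of injective real matrices\<close>

lemma gram_inverse_of_trivial_kernel:
  fixes B :: "real mat"
  assumes B: "B \<in> carrier_mat m r"
    and inj: "\<And>v. v \<in> carrier_vec r \<Longrightarrow> B *\<^sub>v v = 0\<^sub>v m \<Longrightarrow> v = 0\<^sub>v r"
  obtains K where "K \<in> carrier_mat r r" "K * (B\<^sup>T * B) = 1\<^sub>m r" "B\<^sup>T * B * K = 1\<^sub>m r"
proof -
  have BB: "B\<^sup>T * B \<in> carrier_mat r r" using B by auto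
  have "det (B\<^sup>T * B) \<noteq> 0"
  proof
    assume "det (B\<^sup>T * B) = 0"
    then obtain v where v: "v \<in> carrier_vec r" "v \<noteq> 0\<^sub>v r" "B\<^sup>T * B *\<^sub>v v = 0\<^sub>v r"
      using det_0_iff_vec_prod_zero_field[OF BB] by auto
    have Bv: "B *\<^sub>v v \<in> carrier_vec m" using B v by auto
    \<comment> \<open>The squared length of \<open>B v\<close> is the value at \<open>v\<close> of
      the form given by the Gram matrix, so a kernel vector of the Gram matrix is a kernel vector of
      \<open>B\<close>. This is where the scalars must be real.\<close>
    have "(B *\<^sub>v v) \<bullet> (B *\<^sub>v v) = v \<bullet> (B\<^sup>T *\<^sub>v (B *\<^sub>v v))"
      using transpose_vec_mult_scalar[OF B v(1) Bv]
        comm_scalar_prod[OF v(1) mult_mat_vec_carrier[OF transpose_carrier_mat[THEN iffD2, OF B] Bv]]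
      by simp
    also have "B\<^sup>T *\<^sub>v (B *\<^sub>v v) = 0\<^sub>v r"
      using assoc_mult_mat_vec[OF transpose_carrier_mat[THEN iffD2, OF B] B v(1)] v(3) by simp
    finally have "(B *\<^sub>v v) \<bullet>c (B *\<^sub>v v) = 0" using v by simp
    then have "B *\<^sub>v v = 0\<^sub>v m" using conjugate_square_eq_0_vec[OF Bv] by simp
    then show False using inj v by blast
  qed
  from det_non_zero_imp_unit[OF BB this, of ty] obtain K where
    "K \<in> carrier_mat r r" "K * (B\<^sup>T * B) = 1\<^sub>m r" "B\<^sup>T * B * K = 1\<^sub>m r"
    unfolding Units_def ring_mat_def by auto
  then show ?thesis using that by blast
qed

lemma gram_inverse_of_left_inverse:
  fixes B L :: "real mat"
  assumes B: "B \<in> carrier_mat m r" and L: "L \<in> carrier_mat r m" and LB: "L * B = 1\<^sub>m r"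
  obtains K where "K \<in> carrier_mat r r" "K * (B\<^sup>T * B) = 1\<^sub>m r" "B\<^sup>T * B * K = 1\<^sub>m r"
proof (rule gram_inverse_of_trivial_kernel[OF B])
  fix v :: "real vec" assume v: "v \<in> carrier_vec r" "B *\<^sub>v v = 0\<^sub>v m"
  have "v = L * B *\<^sub>v v" using LB v by simp
  also have "\<dots> = L *\<^sub>v 0\<^sub>v m" using assoc_mult_mat_vec[OF L B v(1)] v(2) by simp
  also have "\<dots> = 0\<^sub>v r" using L by auto
  finally show "v = 0\<^sub>v r" .
qed

text \<open>The one-sided inverses \<open>L\<close> and \<open>R\<close> certify that
  \<open>B\<close> has full column rank and \<open>C\<close> full row rank. They allow cancellation
  by pure algebra. The size \<open>r\<close> is a parameter, so that a factorization can be
  exhibited first and its size identified with the rank afterwards.\<close>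

definition rank_factorization ::
  "'a::semiring_1 mat \<Rightarrow> nat \<Rightarrow> 'a mat \<Rightarrow> 'a mat \<Rightarrow> 'a mat \<Rightarrow> 'a mat \<Rightarrow> bool" where
  "rank_factorization A r B C L R \<longleftrightarrow>
     B \<in> carrier_mat (dim_row A) r \<and> C \<in> carrier_mat r (dim_col A) \<and>
     L \<in> carrier_mat r (dim_row A) \<and> R \<in> carrier_mat (dim_col A) r \<and>
     L * B = 1\<^sub>m r \<and> C * R = 1\<^sub>m r \<and> A = B * C"

lemma mat_eq_mult_of_cols:
  fixes A B :: "'a::semiring_0 mat"
  assumes A: "A \<in> carrier_mat m n" and B: "B \<in> carrier_mat m r"
    and ex: "\<And>j. j < n \<Longrightarrow> \<exists>v \<in> carrier_vec r. col A j = B *\<^sub>v v"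
  obtains C where "C \<in> carrier_mat r n" "A = B * C"
proof -
  obtain f where f: "\<And>j. j < n \<Longrightarrow> f j \<in> carrier_vec r" "\<And>j. j < n \<Longrightarrow> col A j = B *\<^sub>v f j"
    using ex by metis
  define C where "C = mat_of_cols r (map f [0..<n])"
  have C: "C \<in> carrier_mat r n" by (rule carrier_matI) (simp_all add: C_def)
  have colC: "col C j = f j" if "j < n" for j
    using that f(1)[OF that] unfolding C_def by (subst col_mat_of_cols) auto
  have "A = B * C"
  proof (rule mat_col_eqI)
    fix j assume "j < dim_col (B * C)"
    then have j: "j < n" using C by simp
    show "col A j = col (B * C) j"
      using col_mult2[OF B C j] colC[OF j] f(2)[OF j] by simp
  qed (use A B C in auto)
  then show ?thesis using C that by blast
qed

lemma mat_mult_unit_vec: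
  fixes A :: "'a::semiring_1 mat"
  assumes "A \<in> carrier_mat m n" "k < n"
  shows "A *\<^sub>v unit_vec n k = col A k"
  using assms by (intro eq_vecI) (auto simp: scalar_prod_right_unit)

text \<open>The columns of \<open>B\<close> are a maximal independent set of columns of
  \<open>A\<close>, and \<open>C\<close> holds the coordinates of the columns of \<open>A\<close> in
  that basis. The Gram matrix of \<open>B\<close> supplies \<open>L\<close>.\<close>

lemma ex_rank_factorization:
  obtains B C L R where "rank_factorization A (mat_rank A) B C L R"
proof -
  define m n where "m = dim_row A" and "n = dim_col A"
  have A: "A \<in> carrier_mat m n" by (simp add: m_def n_def)
  interpret vec_space "TYPE(real)" m .
  let ?P = "\<lambda>T. T \<subseteq> set (cols A) \<and> lin_indpt T"
  have "?P {}" by (simp add: finite_lin_indpt2)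
  then obtain S where S: "finite S" "maximal S ?P"
    using maximal_exists_superset[of "set (cols A)" ?P "{}"] by auto
  have Sc: "S \<subseteq> set (cols A)" "lin_indpt S" using S(2) by (auto simp: maximal_def)
  have cA: "set (cols A) \<subseteq> carrier_vec m" using A cols_dim by blast
  have SV: "S \<subseteq> carrier_vec m" using Sc cA by blast
  obtain bs where bs: "set bs = S" "distinct bs" using S(1) finite_distinct_list by blast
  define r where "r = length bs"
  have r: "r = mat_rank A"
    unfolding r_def mat_rank_def using rank_card_indpt[OF A S(2)] bs distinct_card m_def by metis
  define B where "B = mat_of_cols m bs"
  have B: "B \<in> carrier_mat m r" by (simp add: B_def r_def)
  have colsB: "cols B = bs" unfolding B_def using bs SV by (intro cols_mat_of_cols) auto
  have "B *\<^sub>v v = 0\<^sub>v m \<Longrightarrow> v = 0\<^sub>v r" if "v \<in> carrier_vec r" for v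
    using lin_depI[OF B that] Sc bs colsB by auto
  then obtain K where K: "K \<in> carrier_mat r r" "K * (B\<^sup>T * B) = 1\<^sub>m r"
    using gram_inverse_of_trivial_kernel[OF B] by metis
  define L where "L = K * B\<^sup>T"
  have L: "L \<in> carrier_mat r m" "L * B = 1\<^sub>m r"
    using K B unfolding L_def by (auto simp: mult_assoc_dim)
  \<comment> \<open>A column outside the span could be added to \<open>S\<close>, against
    maximality.\<close>
  have inspan: "u \<in> span S" if "u \<in> set (cols A)" for u
  proof (rule ccontr)
    assume u: "u \<notin> span S"
    then have "lin_indpt (S \<union> {u})"
      using lin_dep_iff_in_span[OF SV Sc(2)] that cA SV span_mem by blast
    moreover have "u \<notin> S" using u SV span_mem by blast
    ultimately show False using S(2) Sc that unfolding maximal_def by blast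
  qed
  have "\<exists>v \<in> carrier_vec r. col A j = B *\<^sub>v v" if "j < n" for j
  proof -
    have "col A j \<in> set (cols A)" using that A by (auto simp: cols_def)
    then have "col A j \<in> span S" by (rule inspan)
    then obtain a where "col A j = lincomb a S" using finite_in_span[OF S(1) SV, of "col A j"] by metis
    then have "col A j = B *\<^sub>v vec r (\<lambda>i. a (col B i))"
      using mat_mult_eq_lincomb[OF B, of a] bs colsB by simp
    then show ?thesis by (intro bexI) auto
  qed
  from mat_eq_mult_of_cols[OF A B this] obtain C where C: "C \<in> carrier_mat r n" "A = B * C"
    by metis
  \<comment> \<open>Each basis vector is itself a column of \<open>A\<close>, so unit vectors select
    it and \<open>B = A * R\<close> for some \<open>R\<close>. Cancelling \<open>B\<close> in
    \<open>B * C * R = B\<close> then makes \<open>R\<close> a right inverse of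
    \<open>C\<close>.\<close>
  have "\<exists>v \<in> carrier_vec n. col B j = A *\<^sub>v v" if j: "j < r" for j
  proof -
    have "col B j = bs ! j" using cols_nth[of j B] j B colsB by simp
    then have "col B j \<in> set (cols A)" using j Sc(1) bs(1) by (auto simp: r_def)
    then obtain k where k: "k < n" "col B j = col A k" using A by (auto simp: cols_def)
    then have "col B j = A *\<^sub>v unit_vec n k" using mat_mult_unit_vec[OF A k(1)] by simp
    then show ?thesis by (intro bexI) auto
  qed
  from mat_eq_mult_of_cols[OF B A this] obtain R where R: "R \<in> carrier_mat n r" "B = A * R"
    by metis
  have "C * R = L * (B * C * R)"
    using B C(1) L R(1) by (simp add: mult_assoc_dim mult_eq_assoc_dim[OF L(2)])
  also have "\<dots> = 1\<^sub>m r" using C(2) R(2) L(2) by simp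
  finally have "rank_factorization A r B C L R"
    unfolding rank_factorization_def carrier_matD[OF A] using B C L R(1) by blast
  then show ?thesis using that r by blast
qed

text \<open>Both products have the same trace, and the trace of an identity matrix is its
  size.\<close>

lemma inverse_dims_eq:
  fixes X Y :: "real mat"
  assumes X: "X \<in> carrier_mat r s" and Y: "Y \<in> carrier_mat s r"
    and XY: "X * Y = 1\<^sub>m r" and YX: "Y * X = 1\<^sub>m s"
  shows "r = s"
proof -
  have "real r = (\<Sum>i<r. (X * Y) $$ (i,i))" by (simp add: XY)
  also have "\<dots> = (\<Sum>i<r. \<Sum>j<s. X $$ (i,j) * Y $$ (j,i))"
    using X Y by (simp add: scalar_prod_def atLeast0LessThan)
  also have "\<dots> = (\<Sum>j<s. \<Sum>i<r. Y $$ (j,i) * X $$ (i,j))"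
    by (subst sum.swap) (simp add: mult.commute)
  also have "\<dots> = (\<Sum>j<s. (Y * X) $$ (j,j))"
    using X Y by (simp add: scalar_prod_def atLeast0LessThan)
  also have "\<dots> = real s" by (simp add: YX)
  finally show ?thesis by simp
qed

text \<open>Any two rank factorizations of \<open>A\<close> differ by a change of basis:
  \<open>L' * B\<close> and \<open>L * B'\<close> are inverse to each other, so the two inner sizes
  agree. Comparison with a factorization of size \<open>mat_rank A\<close> gives the claim.\<close>

lemma rank_factorization_rank:
  assumes "rank_factorization A r B C L R"
  shows "mat_rank A = r"
proof -
  obtain B' C' L' R' where "rank_factorization A (mat_rank A) B' C' L' R'"
    using ex_rank_factorization .
  then have c: "B' \<in> carrier_mat (dim_row A) (mat_rank A)" "C' \<in> carrier_mat (mat_rank A) (dim_col A)"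
      "L' \<in> carrier_mat (mat_rank A) (dim_row A)" "R' \<in> carrier_mat (dim_col A) (mat_rank A)"
    and i: "L' * B' = 1\<^sub>m (mat_rank A)" "C' * R' = 1\<^sub>m (mat_rank A)" and A': "A = B' * C'"
    unfolding rank_factorization_def by blast+
  from assms have d: "B \<in> carrier_mat (dim_row A) r" "C \<in> carrier_mat r (dim_col A)"
      "L \<in> carrier_mat r (dim_row A)" "R \<in> carrier_mat (dim_col A) r"
    and k: "L * B = 1\<^sub>m r" "C * R = 1\<^sub>m r" and A: "A = B * C"
    unfolding rank_factorization_def by blast+
  note f = c d i(2) k(2)
  have eq: "B * C = B' * C'" using A A' by simp
  \<comment> \<open>The change of basis can be read off from the left or from the right factors.
    Both descriptions are needed to form the products \<open>3\<close> and \<open>4\<close>.\<close>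
  have 1: "L' * B = C' * R"
  proof -
    have "L' * B = L' * (B * C * R)" using f by (simp add: mult_assoc_dim)
    also have "\<dots> = C' * R" unfolding eq using f by (simp add: mult_assoc_dim mult_eq_assoc_dim[OF i(1)])
    finally show ?thesis .
  qed
  have 2: "L * B' = C * R'"
  proof -
    have "L * B' = L * (B' * C' * R')" using f by (simp add: mult_assoc_dim)
    also have "\<dots> = C * R'" unfolding eq[symmetric] using f by (simp add: mult_assoc_dim mult_eq_assoc_dim[OF k(1)])
    finally show ?thesis .
  qed
  have "L' * B * (L * B') = L' * (B * C) * R'" unfolding 2 using f by (simp add: mult_assoc_dim)
  also have "\<dots> = 1\<^sub>m (mat_rank A)" unfolding eq using f
    by (simp add: mult_assoc_dim mult_eq_assoc_dim[OF i(1)])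
  finally have 3: "L' * B * (L * B') = 1\<^sub>m (mat_rank A)" .
  have "L * B' * (L' * B) = L * (B' * C') * R" unfolding 1 using f by (simp add: mult_assoc_dim)
  also have "\<dots> = 1\<^sub>m r" unfolding eq[symmetric] using f
    by (simp add: mult_assoc_dim mult_eq_assoc_dim[OF k(1)])
  finally have 4: "L * B' * (L' * B) = 1\<^sub>m r" .
  show ?thesis using inverse_dims_eq[OF _ _ 3 4] f by auto
qed

section \<open>Regular dual matrices\<close>

lemma transpose_mult_dim:
  fixes A B :: "'a::comm_semiring_0 mat"
  assumes "dim_col A = dim_row B"
  shows "(A * B)\<^sup>T = B\<^sup>T * A\<^sup>T"
  using assms by (intro transpose_mult) auto

lemma dual_sum_parts:
  "std_part (sum f S) = (\<Sum>x\<in>S. std_part (f x))" "dual_part (sum f S) = (\<Sum>x\<in>S. dual_part (f x))"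
  by (induction S rule: infinite_finite_induct) (auto simp: zero_dual_def plus_dual_def)

lemma index_dual_mat:
  assumes "A \<in> carrier_mat m n" "A\<^sub>0 \<in> carrier_mat m n" "i < m" "j < n"
  shows "dual_mat A A\<^sub>0 $$ (i, j) = Dual (A $$ (i, j)) (A\<^sub>0 $$ (i, j))"
  using assms by (auto simp: dual_mat_def Dual_conv)

lemma dual_mat_mult:
  assumes "A \<in> carrier_mat m k" "A\<^sub>0 \<in> carrier_mat m k" "B \<in> carrier_mat k n" "B\<^sub>0 \<in> carrier_mat k n"
  shows "dual_mat A A\<^sub>0 * dual_mat B B\<^sub>0 = dual_mat (A * B) (A * B\<^sub>0 + A\<^sub>0 * B)"
proof (rule eq_matI)
  fix i j assume "i < dim_row (dual_mat (A * B) (A * B\<^sub>0 + A\<^sub>0 * B))"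
    "j < dim_col (dual_mat (A * B) (A * B\<^sub>0 + A\<^sub>0 * B))"
  then have ij: "i < m" "j < n" using assms by (auto simp: dual_mat_def)
  have c: "dual_mat A A\<^sub>0 \<in> carrier_mat m k" "dual_mat B B\<^sub>0 \<in> carrier_mat k n"
    using assms by (auto intro: dual_mat_carrier)
  have "(dual_mat A A\<^sub>0 * dual_mat B B\<^sub>0) $$ (i,j) =
      (\<Sum>l = 0..<k. Dual (A $$ (i,l)) (A\<^sub>0 $$ (i,l)) * Dual (B $$ (l,j)) (B\<^sub>0 $$ (l,j)))"
    using ij c index_dual_mat[OF assms(1,2)] index_dual_mat[OF assms(3,4)]
    by (auto simp: scalar_prod_def)
  also have "\<dots> = Dual ((A * B) $$ (i,j)) ((A * B\<^sub>0 + A\<^sub>0 * B) $$ (i,j))"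
    by (rule dual.expand)
      (use ij assms in \<open>auto simp: dual_sum_parts times_dual_def scalar_prod_def sum.distrib\<close>)
  also have "\<dots> = dual_mat (A * B) (A * B\<^sub>0 + A\<^sub>0 * B) $$ (i,j)"
    by (rule index_dual_mat[symmetric, where m = m and n = n]) (use assms ij in auto)
  finally show "(dual_mat A A\<^sub>0 * dual_mat B B\<^sub>0) $$ (i,j) = dual_mat (A * B) (A * B\<^sub>0 + A\<^sub>0 * B) $$ (i,j)" .
qed (use assms in \<open>auto simp: dual_mat_def\<close>)

lemma dual_mat_minus:
  assumes "A \<in> carrier_mat m n" "A\<^sub>0 \<in> carrier_mat m n" "B \<in> carrier_mat m n" "B\<^sub>0 \<in> carrier_mat m n"
  shows "dual_mat A A\<^sub>0 - dual_mat B B\<^sub>0 = dual_mat (A - B) (A\<^sub>0 - B\<^sub>0)"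
  by (rule eq_matI) (use assms in \<open>auto simp: dual_mat_def dual_of_real_def dual_unit_def
      plus_dual_def minus_dual_def times_dual_def\<close>)

lemma dual_mat_transpose:
  assumes "A \<in> carrier_mat m n" "A\<^sub>0 \<in> carrier_mat m n"
  shows "(dual_mat A A\<^sub>0)\<^sup>T = dual_mat A\<^sup>T A\<^sub>0\<^sup>T"
  by (rule eq_matI) (use assms in \<open>auto simp: dual_mat_def\<close>)

lemma dual_mat_one: "dual_mat (1\<^sub>m n) (0\<^sub>m n n) = 1\<^sub>m n"
  by (rule eq_matI) (auto simp: dual_mat_def dual_of_real_def dual_unit_def
      plus_dual_def times_dual_def one_dual_def zero_dual_def)

lemma dual_mat_eqD:
  assumes "A \<in> carrier_mat m n" "A\<^sub>0 \<in> carrier_mat m n" "B \<in> carrier_mat m n" "B\<^sub>0 \<in> carrier_mat m n"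
    and eq: "dual_mat A A\<^sub>0 = dual_mat B B\<^sub>0"
  shows "A = B" "A\<^sub>0 = B\<^sub>0"
proof -
  have "A $$ (i,j) = B $$ (i,j) \<and> A\<^sub>0 $$ (i,j) = B\<^sub>0 $$ (i,j)" if "i < m" "j < n" for i j
    using index_dual_mat[OF assms(1,2) that] index_dual_mat[OF assms(3,4) that] eq by simp
  then show "A = B" "A\<^sub>0 = B\<^sub>0" using assms by (auto intro!: eq_matI)
qed

lemma ex_dual_mat:
  assumes "X \<in> carrier_mat m n"
  obtains A A\<^sub>0 where "A \<in> carrier_mat m n" "A\<^sub>0 \<in> carrier_mat m n" "X = dual_mat A A\<^sub>0"
proof
  show "X = dual_mat (map_mat std_part X) (map_mat dual_part X)"
    by (rule eq_matI) (auto simp: dual_mat_def dual_of_real_def dual_unit_def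
      plus_dual_def times_dual_def)
qed (use assms in auto)

text \<open>An invertible standard part suffices: as \<open>\<epsilon>\<close> squares to zero, the
  Neumann series of the inverse stops after its linear term, leaving the dual part
  \<open>- K * G\<^sub>0 * K\<close>.\<close>

lemma dual_mat_inverse:
  assumes "G \<in> carrier_mat r r" "G\<^sub>0 \<in> carrier_mat r r" "K \<in> carrier_mat r r"
    and "K * G = 1\<^sub>m r" "G * K = 1\<^sub>m r"
  obtains H where "H \<in> carrier_mat r r" "H * dual_mat G G\<^sub>0 = 1\<^sub>m r" "dual_mat G G\<^sub>0 * H = 1\<^sub>m r"
proof
  let ?H = "dual_mat K (0\<^sub>m r r - K * G\<^sub>0 * K)"
  have c: "0\<^sub>m r r - K * G\<^sub>0 * K \<in> carrier_mat r r" using assms by auto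
  show "?H \<in> carrier_mat r r" by (rule dual_mat_carrier[OF c])
  have "K * G\<^sub>0 + (0\<^sub>m r r - K * G\<^sub>0 * K) * G = 0\<^sub>m r r"
    using assms by (simp add: mult_distrib_dim mult_assoc_dim) (auto intro!: eq_matI)
  then show "?H * dual_mat G G\<^sub>0 = 1\<^sub>m r"
    using dual_mat_mult[OF assms(3) c assms(1,2)] assms(4) by (simp add: dual_mat_one)
  have "G * (0\<^sub>m r r - K * G\<^sub>0 * K) + G\<^sub>0 * K = 0\<^sub>m r r"
    using assms by (simp add: mult_distrib_dim mult_assoc_dim mult_eq_assoc_dim[OF assms(5)])
      (auto intro!: eq_matI)
  then show "dual_mat G G\<^sub>0 * ?H = 1\<^sub>m r"
    using dual_mat_mult[OF assms(1,2) assms(3) c] assms(5) by (simp add: dual_mat_one)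
qed

section \<open>Moore-Penrose inverses of dual matrices\<close>

lemma inverse_symmetric:
  fixes K G :: "'a::comm_ring_1 mat"
  assumes "G \<in> carrier_mat r r" "K \<in> carrier_mat r r" "G\<^sup>T = G" "G * K = 1\<^sub>m r"
  shows "K\<^sup>T = K"
proof -
  have "K\<^sup>T * G = 1\<^sub>m r"
    using arg_cong[OF assms(4), of transpose_mat] assms(1-3) by (simp add: transpose_mult_dim)
  then have "K\<^sup>T * (G * K) = K" using assms(1,2) by (simp add: mult_eq_assoc_dim)
  then show ?thesis using assms by simp
qed

text \<open>The classical formula for the Moore-Penrose inverse of a full-rank product, with
  \<open>H\<close> and \<open>J\<close> the inverse Gram matrices of the two factors. The two
  projectors collapse to \<open>B * (H * B\<^sup>T)\<close> and \<open>C\<^sup>T * (J * C)\<close>,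
  which are symmetric because \<open>H\<close> and \<open>J\<close> are.\<close>

lemma dmpgi_of_factorization:
  fixes B C H J :: "dual mat"
  assumes c: "B \<in> carrier_mat m r" "C \<in> carrier_mat r n" "H \<in> carrier_mat r r" "J \<in> carrier_mat r r"
    and i: "H * (B\<^sup>T * B) = 1\<^sub>m r" "B\<^sup>T * B * H = 1\<^sub>m r" "J * (C * C\<^sup>T) = 1\<^sub>m r" "C * C\<^sup>T * J = 1\<^sub>m r"
  shows "is_dmpgi (B * C) (C\<^sup>T * (J * (H * B\<^sup>T)))"
proof -
  have sym: "H\<^sup>T = H" "J\<^sup>T = J"
    by (rule inverse_symmetric[of "B\<^sup>T * B" r], use c i in \<open>simp_all add: transpose_mult_dim\<close>)
      (rule inverse_symmetric[of "C * C\<^sup>T" r], use c i in \<open>simp_all add: transpose_mult_dim\<close>)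
  have i': "B\<^sup>T * (B * H) = 1\<^sub>m r" "C * (C\<^sup>T * J) = 1\<^sub>m r"
    using i c by (simp_all add: mult_assoc_dim)
  note s = mult_assoc_dim i i' mult_eq_assoc3_dim[OF i(1)] mult_eq_assoc3_dim[OF i'(1)]
     mult_eq_assoc3_dim[OF i(3)] mult_eq_assoc3_dim[OF i'(2)]
  let ?X = "C\<^sup>T * (J * (H * B\<^sup>T))"
  have AX: "B * C * ?X = B * (H * B\<^sup>T)" and XA: "?X * (B * C) = C\<^sup>T * (J * C)"
    using c by (simp_all add: s)
  show ?thesis unfolding is_dmpgi_def AX XA
    using c by (simp add: s transpose_mult_dim sym)
qed

text \<open>Comparing dual parts in the inner-inverse equation writes \<open>A\<^sub>0\<close> as a
  sum of terms that begin or end with \<open>A\<close>. Moore-Penrose and group inverses share this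
  equation, so the lemma serves both.\<close>

lemma regular_dual_mat_part:
  assumes c: "A \<in> carrier_mat m n" "A\<^sub>0 \<in> carrier_mat m n" and X: "X \<in> carrier_mat n m"
    and eq: "dual_mat A A\<^sub>0 * X * dual_mat A A\<^sub>0 = dual_mat A A\<^sub>0"
  obtains Z W where "Z \<in> carrier_mat n n" "W \<in> carrier_mat m m" "A\<^sub>0 = A * Z + W * A"
proof -
  obtain Y Y\<^sub>0 where Y: "Y \<in> carrier_mat n m" "Y\<^sub>0 \<in> carrier_mat n m" "X = dual_mat Y Y\<^sub>0"
    using ex_dual_mat[OF X] .
  have "dual_mat A A\<^sub>0 = dual_mat (A * Y * A) (A * Y * A\<^sub>0 + (A * Y\<^sub>0 + A\<^sub>0 * Y) * A)"
    using eq c Y by (simp add: dual_mat_mult[where m = m and k = n and n = m]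
        dual_mat_mult[where m = m and k = m and n = n])
  then have "A\<^sub>0 = A * Y * A\<^sub>0 + (A * Y\<^sub>0 + A\<^sub>0 * Y) * A"
    by (rule dual_mat_eqD(2)[rotated 4]) (use c Y in auto)
  also have "\<dots> = A * (Y * A\<^sub>0 + Y\<^sub>0 * A) + A\<^sub>0 * Y * A"
    using c Y by (simp add: mult_distrib_dim mult_assoc_dim) (auto intro!: eq_matI)
  finally show ?thesis using that[of "Y * A\<^sub>0 + Y\<^sub>0 * A" "A\<^sub>0 * Y"] c Y by auto
qed

text \<open>The converse of \<open>regular_dual_mat_part\<close>: the lifted factors
  \<open>B + \<epsilon>WB\<close> and \<open>C + \<epsilon>CZ\<close> multiply to the given dual
  matrix. Their Gram matrices have the invertible Gram matrices of \<open>B\<close> and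
  \<open>C\<close> as standard parts, hence are invertible over the dual numbers.\<close>

lemma has_dmpgi_dual_mat:
  assumes c: "A \<in> carrier_mat m n" "Z \<in> carrier_mat n n" "W \<in> carrier_mat m m"
  shows "has_dmpgi (dual_mat A (A * Z + W * A))"
proof -
  obtain B C L R where "rank_factorization A (mat_rank A) B C L R"
    using ex_rank_factorization .
  moreover define r where "r = mat_rank A"
  ultimately have d: "B \<in> carrier_mat m r" "C \<in> carrier_mat r n"
      "L \<in> carrier_mat r m" "R \<in> carrier_mat n r"
    and k: "L * B = 1\<^sub>m r" "C * R = 1\<^sub>m r" and A: "A = B * C"
    unfolding rank_factorization_def carrier_matD[OF c(1)] by blast+
  obtain K where K: "K \<in> carrier_mat r r" "K * (B\<^sup>T * B) = 1\<^sub>m r" "B\<^sup>T * B * K = 1\<^sub>m r"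
    using gram_inverse_of_left_inverse[OF d(1,3) k(1)] .
  \<comment> \<open>Transposing turns the right inverse of \<open>C\<close> into a left inverse of
    its transpose, so the Gram lemma also covers \<open>C * C\<^sup>T\<close>.\<close>
  have d': "C\<^sup>T \<in> carrier_mat n r" "R\<^sup>T \<in> carrier_mat r n" using d by auto
  have k': "R\<^sup>T * C\<^sup>T = 1\<^sub>m r" using arg_cong[OF k(2), of transpose_mat] d by (simp add: transpose_mult_dim)
  obtain M where M: "M \<in> carrier_mat r r" "M * (C * C\<^sup>T) = 1\<^sub>m r" "C * C\<^sup>T * M = 1\<^sub>m r"
    using gram_inverse_of_left_inverse[OF d' k'] by auto
  let ?B = "dual_mat B (W * B)" and ?C = "dual_mat C (C * Z)"
  have B: "?B \<in> carrier_mat m r" and C: "?C \<in> carrier_mat r n"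
    using c d by (auto intro!: dual_mat_carrier)
  have G: "B\<^sup>T * B \<in> carrier_mat r r" "B\<^sup>T * (W * B) + (W * B)\<^sup>T * B \<in> carrier_mat r r"
    and G': "C * C\<^sup>T \<in> carrier_mat r r" "C * (C * Z)\<^sup>T + C * Z * C\<^sup>T \<in> carrier_mat r r"
    by (rule carrier_matI; use c d in simp)+
  have "?B\<^sup>T * ?B = dual_mat (B\<^sup>T * B) (B\<^sup>T * (W * B) + (W * B)\<^sup>T * B)"
    using c d by (simp add: dual_mat_transpose[where m = m and n = r]
        dual_mat_mult[where m = r and k = m and n = r])
  then obtain H where H: "H \<in> carrier_mat r r" "H * (?B\<^sup>T * ?B) = 1\<^sub>m r" "?B\<^sup>T * ?B * H = 1\<^sub>m r"
    using dual_mat_inverse[OF G K] by metis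
  have "?C * ?C\<^sup>T = dual_mat (C * C\<^sup>T) (C * (C * Z)\<^sup>T + C * Z * C\<^sup>T)"
    using c d by (simp add: dual_mat_transpose[where m = r and n = n]
        dual_mat_mult[where m = r and k = n and n = r])
  then obtain J where J: "J \<in> carrier_mat r r" "J * (?C * ?C\<^sup>T) = 1\<^sub>m r" "?C * ?C\<^sup>T * J = 1\<^sub>m r"
    using dual_mat_inverse[OF G' M] by metis
  have "?B * ?C = dual_mat A (A * Z + W * A)"
    using c d unfolding A by (simp add: dual_mat_mult[where m = m and k = r and n = n] mult_assoc_dim)
  then show ?thesis using dmpgi_of_factorization[OF B C H(1) J(1) H(2,3) J(2,3)]
    unfolding has_dmpgi_def by metis
qed

section \<open>Block matrices\<close>

lemma append_dims [simp]:
  "dim_row (A @\<^sub>r B) = dim_row A + dim_row B" "dim_col (A @\<^sub>r B) = dim_col A"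
  "dim_row (append_cols A B) = dim_row A" "dim_col (append_cols A B) = dim_col A + dim_col B"
  by (auto simp: append_rows_def append_cols_def)

lemma index_append_rows:
  assumes "dim_col A = dim_col B" "i < dim_row A + dim_row B" "j < dim_col A"
  shows "(A @\<^sub>r B) $$ (i, j) = (if i < dim_row A then A $$ (i, j) else B $$ (i - dim_row A, j))"
  using assms by (simp add: append_rows_def)

lemma index_append_cols:
  assumes "dim_row A = dim_row B" "i < dim_row A" "j < dim_col A + dim_col B"
  shows "append_cols A B $$ (i, j) = (if j < dim_col A then A $$ (i, j) else B $$ (i, j - dim_col A))"
  using assms by (simp add: append_cols_def)

lemma append_rows_mult:
  fixes A B X :: "'a::comm_semiring_1 mat"
  assumes "dim_col A = dim_row X" "dim_col B = dim_row X"
  shows "(A @\<^sub>r B) * X = (A * X) @\<^sub>r (B * X)"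
proof (rule eq_matI)
  fix i j assume ij: "i < dim_row ((A * X) @\<^sub>r (B * X))" "j < dim_col ((A * X) @\<^sub>r (B * X))"
  have "row (A @\<^sub>r B) i = (if i < dim_row A then row A i else row B (i - dim_row A))"
    using ij assms by (intro eq_vecI) (auto simp: index_append_rows)
  then show "((A @\<^sub>r B) * X) $$ (i, j) = ((A * X) @\<^sub>r (B * X)) $$ (i, j)"
    using ij assms by (auto simp: index_append_rows)
qed (use assms in auto)

lemma mult_append_cols:
  fixes A B X :: "'a::comm_semiring_1 mat"
  assumes "dim_col X = dim_row A" "dim_col X = dim_row B"
  shows "X * append_cols A B = append_cols (X * A) (X * B)"
proof (rule eq_matI)
  fix i j assume ij: "i < dim_row (append_cols (X * A) (X * B))" "j < dim_col (append_cols (X * A) (X * B))"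
  have "col (append_cols A B) j = (if j < dim_col A then col A j else col B (j - dim_col A))"
    using ij assms by (intro eq_vecI) (auto simp: index_append_cols)
  then show "(X * append_cols A B) $$ (i, j) = append_cols (X * A) (X * B) $$ (i, j)"
    using ij assms by (auto simp: index_append_cols)
qed (use assms in auto)

lemma append_cols_mult_append_rows:
  fixes A B C D :: "'a::comm_semiring_1 mat"
  assumes "dim_row A = dim_row B" "dim_col C = dim_col D"
    "dim_col A = dim_row C" "dim_col B = dim_row D"
  shows "append_cols A B * (C @\<^sub>r D) = A * C + B * D"
proof (rule eq_matI)
  fix i j assume ij: "i < dim_row (A * C + B * D)" "j < dim_col (A * C + B * D)"
  let ?f = "\<lambda>k. append_cols A B $$ (i, k) * (C @\<^sub>r D) $$ (k, j)"
  have "(append_cols A B * (C @\<^sub>r D)) $$ (i, j) = (\<Sum>k = 0..<dim_row C + dim_row D. ?f k)"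
    using ij assms by (simp add: scalar_prod_def)
  also have "\<dots> = (\<Sum>k = 0..<dim_row C. ?f k) + (\<Sum>k = dim_row C..<dim_row C + dim_row D. ?f k)"
    by (simp add: sum.atLeastLessThan_concat)
  also have "(\<Sum>k = dim_row C..<dim_row C + dim_row D. ?f k) = (\<Sum>k = 0..<dim_row D. ?f (k + dim_row C))"
    using sum.shift_bounds_nat_ivl[of ?f 0 "dim_row C" "dim_row D"] by (simp add: add.commute)
  also have "(\<Sum>k = 0..<dim_row C. ?f k) = (\<Sum>k = 0..<dim_row C. A $$ (i, k) * C $$ (k, j))"
    using ij assms by (intro sum.cong) (auto simp: index_append_cols index_append_rows)
  also have "(\<Sum>k = 0..<dim_row D. ?f (k + dim_row C)) = (\<Sum>k = 0..<dim_row D. B $$ (i, k) * D $$ (k, j))"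
    using ij assms by (intro sum.cong) (auto simp: index_append_cols index_append_rows)
  finally show "(append_cols A B * (C @\<^sub>r D)) $$ (i, j) = (A * C + B * D) $$ (i, j)"
    using ij assms by (simp add: scalar_prod_def)
qed (use assms in auto)

text \<open>This is a block matrix conjugated by \<open>P\<close>, written as the sum of all
  \<open>B_i * A_ij * C_j\<close>. It turns block computations into ring identities between the
  pieces of \<open>P\<close> and of its inverse. The bracketing follows the nesting in
  \<open>block3\<close>.\<close>

definition block_sum ::
  "real mat \<Rightarrow> real mat \<Rightarrow> real mat \<Rightarrow> real mat \<Rightarrow> real mat \<Rightarrow> real mat \<Rightarrow>
   real mat \<Rightarrow> real mat \<Rightarrow> real mat \<Rightarrow> real mat \<Rightarrow> real mat \<Rightarrow> real mat \<Rightarrow>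
   real mat \<Rightarrow> real mat \<Rightarrow> real mat \<Rightarrow> real mat" where
  "block_sum B1 B2 B3 C1 C2 C3 A11 A12 A13 A21 A22 A23 A31 A32 A33 =
     B1 * (A11 * C1 + (A12 * C2 + A13 * C3)) +
     (B2 * (A21 * C1 + (A22 * C2 + A23 * C3)) + B3 * (A31 * C1 + (A32 * C2 + A33 * C3)))"

lemma block3_conj:
  assumes "B1 \<in> carrier_mat n a" "B2 \<in> carrier_mat n b" "B3 \<in> carrier_mat n c"
    and "C1 \<in> carrier_mat a n" "C2 \<in> carrier_mat b n" "C3 \<in> carrier_mat c n"
    and "A11 \<in> carrier_mat a a" "A12 \<in> carrier_mat a b" "A13 \<in> carrier_mat a c"
    and "A21 \<in> carrier_mat b a" "A22 \<in> carrier_mat b b" "A23 \<in> carrier_mat b c"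
    and "A31 \<in> carrier_mat c a" "A32 \<in> carrier_mat c b" "A33 \<in> carrier_mat c c"
  shows "append_cols B1 (append_cols B2 B3) * block3 A11 A12 A13 A21 A22 A23 A31 A32 A33 *
      (C1 @\<^sub>r (C2 @\<^sub>r C3)) = block_sum B1 B2 B3 C1 C2 C3 A11 A12 A13 A21 A22 A23 A31 A32 A33"
proof -
  note d = assms[THEN carrier_matD(1)] assms[THEN carrier_matD(2)]
  show ?thesis
    unfolding block3_def block_sum_def
    by (simp add: d mult_assoc_dim append_rows_mult append_cols_mult_append_rows mult_distrib_dim)
qed

section \<open>Splitting matrices into blocks and comparing blocks\<close>

lemma split_cols3:
  fixes P :: "'a::zero mat"
  assumes "P \<in> carrier_mat n (a + (b + c))"
  obtains B1 B2 B3 where "B1 \<in> carrier_mat n a" "B2 \<in> carrier_mat n b" "B3 \<in> carrier_mat n c"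
    "P = append_cols B1 (append_cols B2 B3)"
proof
  show "P = append_cols (mat n a (\<lambda>(i,j). P $$ (i,j)))
      (append_cols (mat n b (\<lambda>(i,j). P $$ (i, j + a))) (mat n c (\<lambda>(i,j). P $$ (i, j + a + b))))"
    using assms by (intro eq_matI) (auto simp: index_append_cols)
qed auto

lemma split_rows3:
  fixes Q :: "'a::zero mat"
  assumes "Q \<in> carrier_mat (a + (b + c)) n"
  obtains C1 C2 C3 where "C1 \<in> carrier_mat a n" "C2 \<in> carrier_mat b n" "C3 \<in> carrier_mat c n"
    "Q = C1 @\<^sub>r (C2 @\<^sub>r C3)"
proof
  show "Q = mat a n (\<lambda>(i,j). Q $$ (i,j)) @\<^sub>r
      (mat b n (\<lambda>(i,j). Q $$ (i + a, j)) @\<^sub>r mat c n (\<lambda>(i,j). Q $$ (i + a + b, j)))"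
    using assms by (intro eq_matI) (auto simp: index_append_rows)
qed auto

lemma append_rows_eqD:
  assumes "A @\<^sub>r B = C @\<^sub>r D" "dim_row A = dim_row C" "dim_col A = dim_col C"
    "dim_col B = dim_col A" "dim_col D = dim_col C"
  shows "A = C" "B = D"
proof -
  have r: "dim_row B = dim_row D" using arg_cong[OF assms(1), of dim_row] assms(2-) by simp
  show "A = C"
  proof (rule eq_matI)
    fix i j assume "i < dim_row C" "j < dim_col C"
    then show "A $$ (i,j) = C $$ (i,j)"
      using arg_cong[OF assms(1), of "\<lambda>X. X $$ (i,j)"] assms(2-) by (simp add: index_append_rows)
  qed (use assms in auto)
  show "B = D"
  proof (rule eq_matI)
    fix i j assume "i < dim_row D" "j < dim_col D"
    then show "B $$ (i,j) = D $$ (i,j)"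
      using arg_cong[OF assms(1), of "\<lambda>X. X $$ (i + dim_row C,j)"] assms(2-) r
      by (simp add: index_append_rows)
  qed (use assms r in auto)
qed

lemma append_cols_eqD:
  assumes "append_cols A B = append_cols C D" "dim_col A = dim_col C" "dim_row A = dim_row C"
    "dim_row B = dim_row A" "dim_row D = dim_row C"
  shows "A = C" "B = D"
proof -
  have r: "dim_col B = dim_col D" using arg_cong[OF assms(1), of dim_col] assms(2-) by simp
  show "A = C"
  proof (rule eq_matI)
    fix i j assume "i < dim_row C" "j < dim_col C"
    then show "A $$ (i,j) = C $$ (i,j)"
      using arg_cong[OF assms(1), of "\<lambda>X. X $$ (i,j)"] assms(2-) by (simp add: index_append_cols)
  qed (use assms in auto)
  show "B = D"
  proof (rule eq_matI)
    fix i j assume "i < dim_row D" "j < dim_col D"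
    then show "B $$ (i,j) = D $$ (i,j)"
      using arg_cong[OF assms(1), of "\<lambda>X. X $$ (i,j + dim_col C)"] assms(2-) r
      by (simp add: index_append_cols)
  qed (use assms r in auto)
qed

lemma one_mat_block3:
  "1\<^sub>m (a + (b + c)) = (block3 (1\<^sub>m a) (0\<^sub>m a b) (0\<^sub>m a c) (0\<^sub>m b a) (1\<^sub>m b) (0\<^sub>m b c)
     (0\<^sub>m c a) (0\<^sub>m c b) (1\<^sub>m c) :: 'a::comm_semiring_1 mat)"
  unfolding block3_def by (intro eq_matI) (auto simp: index_append_rows index_append_cols)

lemma append_mult_eq_block3:
  fixes B1 B2 B3 C1 C2 C3 :: "'a::comm_semiring_1 mat"
  assumes "B1 \<in> carrier_mat n a" "B2 \<in> carrier_mat n b" "B3 \<in> carrier_mat n c"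
    and "C1 \<in> carrier_mat a n" "C2 \<in> carrier_mat b n" "C3 \<in> carrier_mat c n"
  shows "(C1 @\<^sub>r (C2 @\<^sub>r C3)) * append_cols B1 (append_cols B2 B3) =
    block3 (C1 * B1) (C1 * B2) (C1 * B3) (C2 * B1) (C2 * B2) (C2 * B3) (C3 * B1) (C3 * B2) (C3 * B3)"
  unfolding block3_def using assms by (simp add: append_rows_mult) (simp add: mult_append_cols)

text \<open>The bridge between a matrix with its inverse and a biorthogonal system of blocks. One
  direction counts dimensions when a frame is built from idempotents; the other extracts a frame
  from a given \<open>P\<close>.\<close>

lemma inverse_blocks_iff:
  fixes B1 B2 B3 C1 C2 C3 :: "'a::comm_semiring_1 mat"
  assumes "B1 \<in> carrier_mat n a" "B2 \<in> carrier_mat n b" "B3 \<in> carrier_mat n c"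
    and "C1 \<in> carrier_mat a n" "C2 \<in> carrier_mat b n" "C3 \<in> carrier_mat c n"
  shows "(C1 @\<^sub>r (C2 @\<^sub>r C3)) * append_cols B1 (append_cols B2 B3) = 1\<^sub>m (a + (b + c)) \<longleftrightarrow>
    C1 * B1 = 1\<^sub>m a \<and> C1 * B2 = 0\<^sub>m a b \<and> C1 * B3 = 0\<^sub>m a c \<and>
    C2 * B1 = 0\<^sub>m b a \<and> C2 * B2 = 1\<^sub>m b \<and> C2 * B3 = 0\<^sub>m b c \<and>
    C3 * B1 = 0\<^sub>m c a \<and> C3 * B2 = 0\<^sub>m c b \<and> C3 * B3 = 1\<^sub>m c" (is "?L \<longleftrightarrow> ?R")
proof
  note d = assms[THEN carrier_matD(1)] assms[THEN carrier_matD(2)]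
  assume ?L
  then have eq: "block3 (C1 * B1) (C1 * B2) (C1 * B3) (C2 * B1) (C2 * B2) (C2 * B3)
      (C3 * B1) (C3 * B2) (C3 * B3) = block3 (1\<^sub>m a) (0\<^sub>m a b) (0\<^sub>m a c) (0\<^sub>m b a) (1\<^sub>m b) (0\<^sub>m b c)
     (0\<^sub>m c a) (0\<^sub>m c b) (1\<^sub>m c)"
    unfolding append_mult_eq_block3[OF assms] one_mat_block3 .
  note r = append_rows_eqD[OF eq[unfolded block3_def]]
  have r1: "append_cols (C1 * B1) (append_cols (C1 * B2) (C1 * B3)) =
      append_cols (1\<^sub>m a) (append_cols (0\<^sub>m a b) (0\<^sub>m a c))"
    by (rule r(1)) (simp_all add: d)
  have r23: "append_cols (C2 * B1) (append_cols (C2 * B2) (C2 * B3)) @\<^sub>r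
       append_cols (C3 * B1) (append_cols (C3 * B2) (C3 * B3)) =
      append_cols (0\<^sub>m b a) (append_cols (1\<^sub>m b) (0\<^sub>m b c)) @\<^sub>r
       append_cols (0\<^sub>m c a) (append_cols (0\<^sub>m c b) (1\<^sub>m c))"
    by (rule r(2)) (simp_all add: d)
  have r2: "append_cols (C2 * B1) (append_cols (C2 * B2) (C2 * B3)) =
      append_cols (0\<^sub>m b a) (append_cols (1\<^sub>m b) (0\<^sub>m b c))"
    by (rule append_rows_eqD(1)[OF r23]) (simp_all add: d)
  have r3: "append_cols (C3 * B1) (append_cols (C3 * B2) (C3 * B3)) =
      append_cols (0\<^sub>m c a) (append_cols (0\<^sub>m c b) (1\<^sub>m c))"
    by (rule append_rows_eqD(2)[OF r23]) (simp_all add: d)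
  have c1: "C1 * B1 = 1\<^sub>m a" "append_cols (C1 * B2) (C1 * B3) = append_cols (0\<^sub>m a b) (0\<^sub>m a c)"
    by (rule append_cols_eqD[OF r1]; simp add: d)+
  have c2: "C2 * B1 = 0\<^sub>m b a" "append_cols (C2 * B2) (C2 * B3) = append_cols (1\<^sub>m b) (0\<^sub>m b c)"
    by (rule append_cols_eqD[OF r2]; simp add: d)+
  have c3: "C3 * B1 = 0\<^sub>m c a" "append_cols (C3 * B2) (C3 * B3) = append_cols (0\<^sub>m c b) (1\<^sub>m c)"
    by (rule append_cols_eqD[OF r3]; simp add: d)+
  have "C1 * B2 = 0\<^sub>m a b" "C1 * B3 = 0\<^sub>m a c"
    by (rule append_cols_eqD[OF c1(2)]; simp add: d)+
  moreover have "C2 * B2 = 1\<^sub>m b" "C2 * B3 = 0\<^sub>m b c"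
    by (rule append_cols_eqD[OF c2(2)]; simp add: d)+
  moreover have "C3 * B2 = 0\<^sub>m c b" "C3 * B3 = 1\<^sub>m c"
    by (rule append_cols_eqD[OF c3(2)]; simp add: d)+
  ultimately show ?R using c1 c2 c3 by blast
next
  assume ?R then show ?L unfolding append_mult_eq_block3[OF assms] one_mat_block3 by simp
qed

section \<open>Idempotents and the minus order\<close>

text \<open>Cancelling the outer factors in \<open>B * C * B * C = B * C\<close> leaves
  \<open>C * B = 1\<close>.\<close>

lemma idempotent_factorization:
  fixes A :: "real mat"
  assumes A: "A \<in> carrier_mat n n" and idem: "A * A = A"
  obtains r B C where "B \<in> carrier_mat n r" "C \<in> carrier_mat r n" "C * B = 1\<^sub>m r" "A = B * C"
proof -
  obtain B C L R where "rank_factorization A (mat_rank A) B C L R"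
    using ex_rank_factorization .
  moreover define r where "r = mat_rank A"
  ultimately have d: "B \<in> carrier_mat n r" "C \<in> carrier_mat r n"
      "L \<in> carrier_mat r n" "R \<in> carrier_mat n r"
    and k: "L * B = 1\<^sub>m r" "C * R = 1\<^sub>m r" and A: "A = B * C"
    unfolding rank_factorization_def carrier_matD[OF A] by blast+
  have "C * B = L * (B * C * (B * C)) * R"
    using d k(2) by (simp add: mult_assoc_dim mult_eq_assoc_dim[OF k(1)])
  also have "\<dots> = L * (B * C) * R" using idem A by simp
  also have "\<dots> = 1\<^sub>m r"
    using d k(2) by (simp add: mult_assoc_dim mult_eq_assoc_dim[OF k(1)])
  finally show ?thesis using that d A by blast
qed

text \<open>\<open>A\<close> has the rank of the idempotent \<open>X * A\<close>: one has
  \<open>A = (A * U) * V\<close>, and \<open>V * X\<close> is a left inverse of \<open>A * U\<close>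
  because \<open>V * X * A * U = V * U * V * U\<close>.\<close>

lemma group_inverse_rank:
  fixes A X U V :: "real mat"
  assumes c: "A \<in> carrier_mat n n" "X \<in> carrier_mat n n" "U \<in> carrier_mat n r" "V \<in> carrier_mat r n"
    and AXA: "A * (X * A) = A" and XA: "X * A = U * V" and VU: "V * U = 1\<^sub>m r"
  shows "mat_rank A = r"
proof -
  have "V * (X * (A * U)) = 1\<^sub>m r"
    using c VU by (simp add: mult_eq_assoc_dim[OF XA] mult_eq_assoc_dim[OF VU] mult_assoc_dim)
  moreover have "A * (U * V) = A" using AXA XA by simp
  ultimately have "rank_factorization A r (A * U) V (V * X) U"
    unfolding rank_factorization_def using c VU by (simp add: mult_assoc_dim)
  then show ?thesis by (rule rank_factorization_rank)
qed

text \<open>Rank additivity makes the joined factors of \<open>E\<close> and \<open>F - E\<close> a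
  full-rank factorization \<open>F = U * V\<close>. Hence \<open>V * Y * U = 1\<close> for every
  inner inverse \<open>Y\<close> of \<open>F\<close>. Since \<open>E\<close> is obtained from
  \<open>U\<close> and \<open>V\<close> by keeping only its own part of a factor, the three
  absorption rules follow.\<close>

lemma minus_le_ginv:
  assumes c: "E \<in> carrier_mat m n" "F \<in> carrier_mat m n" "Y \<in> carrier_mat n m"
    and FYF: "F * (Y * F) = F" and le: "minus_le E F"
  shows "E * (Y * E) = E" "F * (Y * E) = E" "E * (Y * F) = E"
proof -
  define G where "G = F - E"
  have G: "G \<in> carrier_mat m n" using c by (auto simp: G_def)
  define a b where "a = mat_rank E" and "b = mat_rank G"
  have rF: "mat_rank F = a + b" using le by (simp add: minus_le_def G_def a_def b_def)
  obtain Be Ce Le Re where "rank_factorization E a Be Ce Le Re"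
    unfolding a_def by (rule ex_rank_factorization)
  then have e: "Be \<in> carrier_mat m a" "Ce \<in> carrier_mat a n" and E: "E = Be * Ce"
    unfolding rank_factorization_def carrier_matD[OF c(1)] by blast+
  obtain Bg Cg Lg Rg where "rank_factorization G b Bg Cg Lg Rg"
    unfolding b_def by (rule ex_rank_factorization)
  then have g: "Bg \<in> carrier_mat m b" "Cg \<in> carrier_mat b n" and Gf: "G = Bg * Cg"
    unfolding rank_factorization_def carrier_matD[OF G] by blast+
  obtain B C L R where "rank_factorization F (a + b) B C L R"
    unfolding rF[symmetric] by (rule ex_rank_factorization)
  then have f: "B \<in> carrier_mat m (a + b)" "C \<in> carrier_mat (a + b) n"
      "L \<in> carrier_mat (a + b) m" "R \<in> carrier_mat n (a + b)"
    and k: "L * B = 1\<^sub>m (a + b)" "C * R = 1\<^sub>m (a + b)" and F: "F = B * C"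
    unfolding rank_factorization_def carrier_matD[OF c(2)] by blast+
  define U V where "U = append_cols Be Bg" and "V = Ce @\<^sub>r Cg"
  have UV: "U \<in> carrier_mat m (a + b)" "V \<in> carrier_mat (a + b) n"
    using e g by (simp_all add: U_def V_def append_cols_carrier)
  have FUV: "F = U * V"
  proof -
    have "F = E + G" using c by (auto simp: G_def intro!: eq_matI)
    then show ?thesis using e g unfolding U_def V_def
      by (simp add: append_cols_mult_append_rows E Gf)
  qed
  have BC: "B * C = U * V" using F FUV by simp
  have 1: "L * U * (V * R) = 1\<^sub>m (a + b)"
  proof -
    have "L * U * (V * R) = L * (U * V) * R" using f(3,4) UV by (simp add: mult_assoc_dim)
    also have "\<dots> = 1\<^sub>m (a + b)" unfolding BC[symmetric]
      using f k(2) by (simp add: mult_assoc_dim mult_eq_assoc_dim[OF k(1)])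
    finally show ?thesis .
  qed
  \<comment> \<open>Both factors are square of size \<open>a + b\<close>, exactly because the ranks
    add up, so the one-sided inverse is two-sided.\<close>
  have 2: "V * R * (L * U) = 1\<^sub>m (a + b)"
    by (rule mat_mult_left_right_inverse[OF _ _ 1]) (use f(3,4) UV in auto)
  \<comment> \<open>Multiplying on both sides by \<open>V * R * (L * U)\<close>, which is the
    identity, creates \<open>U * V * Y * U * V\<close> in the middle. There
    \<open>F * Y * F = F\<close> removes \<open>Y\<close>.\<close>
  have VYU: "V * (Y * U) = 1\<^sub>m (a + b)"
  proof -
    have "V * (Y * U) = V * R * (L * U) * (V * (Y * U)) * (V * R * (L * U))"
      using UV c by (simp add: 2)
    also have "\<dots> = V * (R * (L * ((U * V) * (Y * (U * V)) * (R * (L * U)))))"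
      using UV c(3) f(3,4) by (simp add: mult_assoc_dim)
    also have "(U * V) * (Y * (U * V)) = U * V" using FYF FUV by simp
    also have "V * (R * (L * (U * V * (R * (L * U))))) = V * R * (L * U) * (V * R * (L * U))"
      using UV f(3,4) by (simp add: mult_assoc_dim)
    also have "\<dots> = 1\<^sub>m (a + b)" by (simp add: 2)
    finally show ?thesis .
  qed
  \<comment> \<open>Padding the factors of \<open>E\<close> with zeros lets \<open>E\<close> share
    the factor \<open>U\<close> or \<open>V\<close> with \<open>F\<close>, so that
    \<open>VYU\<close> applies.\<close>
  define Q T where "Q = Ce @\<^sub>r 0\<^sub>m b n" and "T = append_cols Be (0\<^sub>m m b)"
  have QT: "Q \<in> carrier_mat (a + b) n" "T \<in> carrier_mat m (a + b)"
    using e by (simp_all add: Q_def T_def append_cols_carrier)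
  have EQ: "E = U * Q" and ET: "E = T * V" and TQ: "E = T * Q"
    unfolding U_def V_def Q_def T_def E using e g by (simp_all add: append_cols_mult_append_rows)
  have "F * (Y * E) = U * Q" unfolding FUV EQ
    using UV QT c(3) by (simp add: mult_assoc_dim mult_eq_assoc3_dim[OF VYU])
  then show "F * (Y * E) = E" using EQ by simp
  have "T * V * (Y * (U * V)) = T * V"
    using UV QT c(3) by (simp add: mult_assoc_dim mult_eq_assoc3_dim[OF VYU])
  then show "E * (Y * F) = E" using FUV ET by metis
  have "T * V * (Y * (U * Q)) = T * Q"
    using UV QT c(3) by (simp add: mult_assoc_dim mult_eq_assoc3_dim[OF VYU])
  then show "E * (Y * E) = E" using EQ ET TQ by metis
qed

text \<open>The \<open>B_i\<close> are the block columns of \<open>P\<close>, and the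
  \<open>C_i\<close> the block rows of its inverse. The relations \<open>CB\<close> and
  \<open>BC\<close> express the two products being the identity, so \<open>a + b + c = n\<close> is
  a consequence.\<close>

locale block_frame =
  fixes n a b c :: nat and B1 B2 B3 C1 C2 C3 :: "real mat"
  assumes carriers: "B1 \<in> carrier_mat n a" "B2 \<in> carrier_mat n b" "B3 \<in> carrier_mat n c"
      "C1 \<in> carrier_mat a n" "C2 \<in> carrier_mat b n" "C3 \<in> carrier_mat c n"
    and CB: "C1 * B1 = 1\<^sub>m a" "C1 * B2 = 0\<^sub>m a b" "C1 * B3 = 0\<^sub>m a c"
      "C2 * B1 = 0\<^sub>m b a" "C2 * B2 = 1\<^sub>m b" "C2 * B3 = 0\<^sub>m b c"
      "C3 * B1 = 0\<^sub>m c a" "C3 * B2 = 0\<^sub>m c b" "C3 * B3 = 1\<^sub>m c"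
    and BC: "B1 * C1 + (B2 * C2 + B3 * C3) = 1\<^sub>m n"
begin

lemmas dims [simp] = carriers[THEN carrier_matD(1)] carriers[THEN carrier_matD(2)]

lemmas CB_simps [simp] = CB CB[THEN mult_eq_assoc_dim]

abbreviation "blocks \<equiv> block_sum B1 B2 B3 C1 C2 C3"

text \<open>Insert the resolution of the identity \<open>BC\<close> on both sides of
  \<open>T\<close>.\<close>

lemma blocks_eq:
  assumes T: "T \<in> carrier_mat n n"
  shows "T = blocks (C1 * T * B1) (C1 * T * B2) (C1 * T * B3)
    (C2 * T * B1) (C2 * T * B2) (C2 * T * B3) (C3 * T * B1) (C3 * T * B2) (C3 * T * B3)"
proof -
  have "T = (B1 * C1 + (B2 * C2 + B3 * C3)) * T * (B1 * C1 + (B2 * C2 + B3 * C3))"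
    using T by (simp add: BC)
  also have "\<dots> = blocks (C1 * T * B1) (C1 * T * B2) (C1 * T * B3)
    (C2 * T * B1) (C2 * T * B2) (C2 * T * B3) (C3 * T * B1) (C3 * T * B2) (C3 * T * B3)"
    \<comment> \<open>After distribution only the order of summands differs. Without
      \<open>index_mult_mat(1)\<close> the entries of products stay atomic, and comparing entries is
      additive rearrangement; the same device recurs below.\<close>
    using T by (simp add: block_sum_def mult_assoc_dim mult_distrib_dim)
      (intro eq_matI; simp del: index_mult_mat(1))
  finally show ?thesis .
qed

end

section \<open>The frame of a minus-ordered pair\<close>

lemma diff_zero_dim [simp]:
  fixes A :: "'a::group_add mat"
  shows "dim_row A = m \<Longrightarrow> dim_col A = n \<Longrightarrow> A - 0\<^sub>m m n = A"
  by (intro eq_matI) auto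

lemma diff_self_dim [simp]:
  fixes A :: "'a::group_add mat"
  shows "A - A = 0\<^sub>m (dim_row A) (dim_col A)"
  by (intro eq_matI) auto

lemma add_zero_dim [simp]:
  fixes A :: "'a::monoid_add mat"
  shows "dim_row A = m \<Longrightarrow> dim_col A = n \<Longrightarrow> A + 0\<^sub>m m n = A"
    "dim_row A = m \<Longrightarrow> dim_col A = n \<Longrightarrow> 0\<^sub>m m n + A = A"
  by (intro eq_matI; simp)+

text \<open>Multiplying the vanishing product by \<open>C\<close> on the left and \<open>B'\<close>
  on the right cancels its outer factors.\<close>

lemma orthogonal_factors:
  fixes B C B' C' :: "real mat"
  assumes "B \<in> carrier_mat n r" "C \<in> carrier_mat r n" "B' \<in> carrier_mat n s" "C' \<in> carrier_mat s n"
    and CB: "C * B = 1\<^sub>m r" "C' * B' = 1\<^sub>m s" and 0: "(B * C) * (B' * C') = 0\<^sub>m n n"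
  shows "C * B' = 0\<^sub>m r s"
proof -
  have "C * B' = C * ((B * C) * (B' * C')) * B'"
    using assms(1-4) by (simp add: mult_assoc_dim CB mult_eq_assoc_dim[OF CB(1)] mult_eq_assoc_dim[OF CB(2)])
  also have "\<dots> = 0\<^sub>m r s" unfolding 0 using assms(1-4) by simp
  finally show ?thesis .
qed

text \<open>The absorption rules for \<open>E\<close> and \<open>F\<close> make
  \<open>p = X * E\<close> and \<open>q = Y * F\<close> nested idempotents, so \<open>p\<close>,
  \<open>q - p\<close> and \<open>1 - q\<close> split the space. Their factors form the frame; the
  block sizes are first anonymous and then identified through ranks and a trace count.\<close>

lemma ex_block_frame:
  fixes E F X Y :: "real mat"
  assumes c: "E \<in> carrier_mat n n" "F \<in> carrier_mat n n" "X \<in> carrier_mat n n" "Y \<in> carrier_mat n n"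
    and E: "E * (X * E) = E" "E * X = X * E" and F: "F * (Y * F) = F" "F * Y = Y * F"
    and EF: "F * (Y * E) = E" "E * (Y * F) = E"
  obtains B1 B2 B3 C1 C2 C3 where
    "block_frame n (mat_rank E) (mat_rank F - mat_rank E) (n - mat_rank F) B1 B2 B3 C1 C2 C3"
    "mat_rank E \<le> mat_rank F" "X * E = B1 * C1" "Y * F = B1 * C1 + B2 * C2"
proof -
  define p q where "p = X * E" and "q = Y * F"
  have pq: "p \<in> carrier_mat n n" "q \<in> carrier_mat n n" using c by (simp_all add: p_def q_def)
  have pp: "p * p = p" unfolding p_def using c by (simp add: mult_assoc_dim E)
  have qq: "q * q = q" unfolding q_def using c by (simp add: mult_assoc_dim F)
  have pq': "p * q = p" unfolding p_def q_def using c by (simp add: mult_assoc_dim EF)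
  \<comment> \<open>Commutation with the group inverses rewrites \<open>q\<close> as
    \<open>F * Y\<close> and \<open>p\<close> as \<open>E * X\<close>, which brings
    \<open>F * Y * E = E\<close> into play.\<close>
  have qp: "q * p = p"
  proof -
    have "q * p = F * (Y * E) * X"
      unfolding p_def q_def E(2)[symmetric] F(2)[symmetric] using c by (simp add: mult_assoc_dim)
    then show ?thesis by (simp add: EF p_def E)
  qed
  note s = mult_distrib_dim pp qq pq' qp
  have c3: "1\<^sub>m n - q \<in> carrier_mat n n" and c2: "q - p \<in> carrier_mat n n" using pq by auto
  have i2: "(q - p) * (q - p) = q - p" using pq by (simp add: s)
  have i3: "(1\<^sub>m n - q) * (1\<^sub>m n - q) = 1\<^sub>m n - q" using pq by (simp add: s)
  obtain a B1 C1 where 1: "B1 \<in> carrier_mat n a" "C1 \<in> carrier_mat a n" "C1 * B1 = 1\<^sub>m a" "p = B1 * C1"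
    using idempotent_factorization[OF pq(1) pp] .
  obtain b B2 C2 where 2: "B2 \<in> carrier_mat n b" "C2 \<in> carrier_mat b n" "C2 * B2 = 1\<^sub>m b" "q - p = B2 * C2"
    using idempotent_factorization[OF c2 i2] .
  obtain d B3 C3 where 3: "B3 \<in> carrier_mat n d" "C3 \<in> carrier_mat d n" "C3 * B3 = 1\<^sub>m d" "1\<^sub>m n - q = B3 * C3"
    using idempotent_factorization[OF c3 i3] .
  have o: "p * (q - p) = 0\<^sub>m n n" "(q - p) * p = 0\<^sub>m n n" "p * (1\<^sub>m n - q) = 0\<^sub>m n n"
    "(1\<^sub>m n - q) * p = 0\<^sub>m n n" "(q - p) * (1\<^sub>m n - q) = 0\<^sub>m n n" "(1\<^sub>m n - q) * (q - p) = 0\<^sub>m n n"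
    using pq by (simp_all add: s)
  have z: "C1 * B2 = 0\<^sub>m a b" "C2 * B1 = 0\<^sub>m b a" "C1 * B3 = 0\<^sub>m a d"
    "C3 * B1 = 0\<^sub>m d a" "C2 * B3 = 0\<^sub>m b d" "C3 * B2 = 0\<^sub>m d b"
    using orthogonal_factors[OF 1(1,2) 2(1,2) 1(3) 2(3)] orthogonal_factors[OF 2(1,2) 1(1,2) 2(3) 1(3)]
      orthogonal_factors[OF 1(1,2) 3(1,2) 1(3) 3(3)] orthogonal_factors[OF 3(1,2) 1(1,2) 3(3) 1(3)]
      orthogonal_factors[OF 2(1,2) 3(1,2) 2(3) 3(3)] orthogonal_factors[OF 3(1,2) 2(1,2) 3(3) 2(3)]
      o unfolding 1(4)[symmetric] 2(4)[symmetric] 3(4)[symmetric] by blast+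
  have qf: "q = B1 * C1 + B2 * C2"
    unfolding 1(4)[symmetric] 2(4)[symmetric] using pq by (intro eq_matI) auto
  have I: "B1 * C1 + (B2 * C2 + B3 * C3) = 1\<^sub>m n"
    unfolding 1(4)[symmetric] 2(4)[symmetric] 3(4)[symmetric] using pq by (intro eq_matI) auto
  have fr: "block_frame n a b d B1 B2 B3 C1 C2 C3"
    by unfold_locales (fact 1 2 3 z I)+
  have rE: "mat_rank E = a"
    by (rule group_inverse_rank[OF c(1,3) 1(1,2) E(1) _ 1(3)]) (use 1(4) p_def in simp)
  have U: "append_cols B1 B2 \<in> carrier_mat n (a + b)" "C1 @\<^sub>r C2 \<in> carrier_mat (a + b) n"
    using 1 2 by (simp_all add: append_cols_carrier)
  \<comment> \<open>The first two frame pieces together factor the idempotent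
    \<open>q = Y * F\<close>, so its rank is the sum of their sizes.\<close>
  have rF: "mat_rank F = a + b"
  proof (rule group_inverse_rank[OF c(2,4) U F(1)])
    show "Y * F = append_cols B1 B2 * (C1 @\<^sub>r C2)"
      using 1(1,2) 2(1,2) qf q_def by (simp add: append_cols_mult_append_rows)
    have "(C1 @\<^sub>r C2) * append_cols B1 B2 =
        append_cols (1\<^sub>m a) (0\<^sub>m a b) @\<^sub>r append_cols (0\<^sub>m b a) (1\<^sub>m b)"
      using 1(1,2) 2(1,2) by (simp add: append_rows_mult) (simp add: mult_append_cols 1(3) 2(3) z)
    also have "\<dots> = 1\<^sub>m (a + b)"
      by (intro eq_matI) (auto simp: index_append_rows index_append_cols)
    finally show "(C1 @\<^sub>r C2) * append_cols B1 B2 = 1\<^sub>m (a + b)" .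
  qed
  have n: "n = a + (b + d)"
  proof (rule inverse_dims_eq)
    show "append_cols B1 (append_cols B2 B3) * (C1 @\<^sub>r (C2 @\<^sub>r C3)) = 1\<^sub>m n"
      using 1(1,2) 2(1,2) 3(1,2) by (simp add: append_cols_mult_append_rows I)
    show "(C1 @\<^sub>r (C2 @\<^sub>r C3)) * append_cols B1 (append_cols B2 B3) = 1\<^sub>m (a + (b + d))"
      by (subst inverse_blocks_iff[OF 1(1) 2(1) 3(1) 1(2) 2(2) 3(2)]) (use 1(3) 2(3) 3(3) z in blast)
    show "append_cols B1 (append_cols B2 B3) \<in> carrier_mat n (a + (b + d))"
      "C1 @\<^sub>r (C2 @\<^sub>r C3) \<in> carrier_mat (a + (b + d)) n"
      using 1 2 3 by (simp_all add: append_cols_carrier)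
  qed
  have d: "mat_rank F - mat_rank E = b" "n - mat_rank F = d" using rE rF n by simp_all
  show ?thesis
  proof
    show "block_frame n (mat_rank E) (mat_rank F - mat_rank E) (n - mat_rank F) B1 B2 B3 C1 C2 C3"
      unfolding d unfolding rE by (rule fr)
  qed (use rE rF 1(4) qf p_def q_def in simp_all)
qed

text \<open>The minus order enters only through \<open>EYE\<close>, \<open>FYE\<close> and
  \<open>EYF\<close>. By \<open>XE\<close> and \<open>YF\<close>, the first summand of the frame is
  the range of \<open>E\<close>, and the first two together are the range of
  \<open>F\<close>.\<close>

locale minus_pair = block_frame +
  fixes E F X Y :: "real mat"
  assumes c: "E \<in> carrier_mat n n" "F \<in> carrier_mat n n" "X \<in> carrier_mat n n" "Y \<in> carrier_mat n n"
    and EXE: "E * (X * E) = E" "E * X = X * E" and FYF: "F * (Y * F) = F" "F * Y = Y * F"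
    and YFY: "Y * (F * Y) = Y"
    and EYE: "E * (Y * E) = E" and FYE: "F * (Y * E) = E" and EYF: "E * (Y * F) = E"
    and XE: "X * E = B1 * C1" and YF: "Y * F = B1 * C1 + B2 * C2"
begin

lemmas dims' [simp] = c[THEN carrier_matD(1)] c[THEN carrier_matD(2)]

lemma absorb: "E * (B1 * C1) = E" "B1 * (C1 * E) = E" "F * (B1 * C1 + B2 * C2) = F" "(B1 * C1 + B2 * C2) * F = F"
proof -
  show "E * (B1 * C1) = E" using EXE XE by simp
  have "B1 * C1 * E = E * X * E" using EXE(2) XE by simp
  then show "B1 * (C1 * E) = E" using EXE(1) by (simp add: mult_assoc_dim)
  show "F * (B1 * C1 + B2 * C2) = F" using FYF YF by simp
  have "(B1 * C1 + B2 * C2) * F = F * Y * F" using FYF(2) YF by simp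
  then show "(B1 * C1 + B2 * C2) * F = F" using FYF(1) by (simp add: mult_assoc_dim)
qed

text \<open>Inserting the projectors from \<open>absorb\<close> next to \<open>E\<close> or
  \<open>F\<close> and using biorthogonality accounts for all zero blocks of the standard
  parts.\<close>

lemma vanishing: "C2 * E = 0\<^sub>m b n" "C3 * E = 0\<^sub>m c n" "E * B2 = 0\<^sub>m n b" "E * B3 = 0\<^sub>m n c"
  "C3 * F = 0\<^sub>m c n" "F * B3 = 0\<^sub>m n c"
proof -
  have "C2 * E = C2 * (B1 * (C1 * E))" "C3 * E = C3 * (B1 * (C1 * E))"
    "E * B2 = E * (B1 * C1) * B2" "E * B3 = E * (B1 * C1) * B3"
    "C3 * F = C3 * ((B1 * C1 + B2 * C2) * F)" "F * B3 = F * (B1 * C1 + B2 * C2) * B3"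
    unfolding absorb by (rule refl)+
  then show "C2 * E = 0\<^sub>m b n" "C3 * E = 0\<^sub>m c n" "E * B2 = 0\<^sub>m n b" "E * B3 = 0\<^sub>m n c"
    "C3 * F = 0\<^sub>m c n" "F * B3 = 0\<^sub>m n c"
    by (simp_all add: mult_assoc_dim mult_distrib_dim)
qed

lemmas vanishing_simps [simp] = vanishing vanishing[THEN mult_eq_assoc_dim]

text \<open>\<open>H\<close> is a generalized inverse of \<open>F - E\<close> supported on the second summand of the frame; hence
  its block \<open>K\<close> there inverts \<open>D\<^sub>2\<close>.\<close>

definition "H = Y - Y * (E * Y)"
definition "K = C2 * (H * B2)"
definition "D1 = C1 * (E * B1)"
definition "D2 = C2 * (F * B2)"
text \<open>\<open>R\<close> and \<open>S\<close> are forced by the required blocks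
  \<open>R * D2\<close> and \<open>D2 * S\<close> of \<open>F\<close>, with \<open>K\<close> as the
  inverse of \<open>D2\<close>.\<close>

definition "R = C1 * (F * (B2 * K))"
definition "S = K * (C2 * (F * B1))"

lemma H [simp]: "dim_row H = n" "dim_col H = n" by (simp_all add: H_def)

lemma EH: "E * H = 0\<^sub>m n n" and HE: "H * E = 0\<^sub>m n n"
  by (simp_all add: H_def mult_distrib_dim mult_assoc_dim EYE mult_eq_assoc3_dim[OF EYE])

text \<open>The term subtracted in \<open>H\<close> contributes
  \<open>F * Y * E * Y * F = E\<close>. As \<open>H\<close> factors through \<open>K\<close>, this
  is the Schur-complement identity behind the (1,1) block of \<open>F\<close>.\<close>

lemma FHF: "F * (H * F) = F - E"
  by (simp add: H_def mult_distrib_dim mult_assoc_dim FYF FYE mult_eq_assoc3_dim[OF FYE] EYF)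

text \<open>\<open>H\<close> is fixed by the projector \<open>Y * F\<close> on either side, and
  \<open>E * H = H * E = 0\<close> kills its component in the first summand. Only the second summand
  remains.\<close>

lemma B2H: "B2 * (C2 * H) = H" and HB2: "H * (B2 * C2) = H"
proof -
  have 1: "H = Y * (F * H)"
    by (simp add: H_def mult_distrib_dim mult_assoc_dim YFY mult_eq_assoc3_dim[OF FYE])
  have 2: "H = H * (F * Y)"
    by (simp add: H_def mult_distrib_dim mult_assoc_dim YFY)
  have 3: "X * (E * H) = 0\<^sub>m n n" "H * (E * X) = 0\<^sub>m n n"
    using EH mult_eq_assoc_dim[OF HE, of X] by simp_all
  have 4: "B1 * (C1 * H) = 0\<^sub>m n n" "H * (B1 * C1) = 0\<^sub>m n n"
    using 3 XE EXE(2) by (simp_all add: mult_eq_assoc_dim[OF XE] mult_assoc_dim)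
  have "H = B1 * (C1 * H) + B2 * (C2 * H)"
    using 1 by (simp add: mult_eq_assoc_dim[OF YF] mult_distrib_dim mult_assoc_dim)
  then show "B2 * (C2 * H) = H" using 4(1) by simp
  have "H = H * (B1 * C1) + H * (B2 * C2)"
    using 2 FYF(2) YF by (simp add: mult_distrib_dim)
  then show "H * (B2 * C2) = H" using 4(2) by simp
qed

lemma K: "B2 * (K * C2) = H" "K \<in> carrier_mat b b"
proof -
  show "B2 * (K * C2) = H" by (simp add: K_def mult_assoc_dim HB2 B2H)
  show "K \<in> carrier_mat b b" by (rule carrier_matI) (simp_all add: K_def)
qed

lemma dimsK [simp]: "dim_row K = b" "dim_col K = b"
  using K(2) by auto

lemmas pair_simps = mult_assoc_dim mult_distrib_dim mult_eq_assoc3_dim[OF K(1)] K(1) FHF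
  mult_eq_assoc3_dim[OF FHF] EH HE mult_eq_assoc_dim[OF EH] mult_eq_assoc_dim[OF HE]

lemma D2_inverse: "D2 * K = 1\<^sub>m b" "K * D2 = 1\<^sub>m b"
proof -
  have D2: "D2 \<in> carrier_mat b b" by (rule carrier_matI) (simp_all add: D2_def)
  have "D2 * K = C2 * (F * (B2 * (C2 * H) * B2))" unfolding D2_def K_def by (simp add: mult_assoc_dim)
  also have "\<dots> = C2 * (F * (H * B2))" unfolding B2H ..
  \<comment> \<open>The other term of \<open>H\<close> becomes \<open>C2 * E * Y * B2\<close>, which
    is zero.\<close>
  also have "\<dots> = C2 * (F * Y * B2)" by (simp add: H_def mult_distrib_dim mult_assoc_dim mult_eq_assoc3_dim[OF FYE])
  also have "\<dots> = 1\<^sub>m b" unfolding FYF(2) YF by (simp add: mult_distrib_dim mult_assoc_dim)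
  finally show "D2 * K = 1\<^sub>m b" .
  from mat_mult_left_right_inverse[OF D2 K(2) this] show "K * D2 = 1\<^sub>m b" .
qed

lemma D1_inverse: "D1 * (C1 * (X * B1)) = 1\<^sub>m a" "C1 * (X * B1) * D1 = 1\<^sub>m a"
proof -
  have D1: "D1 \<in> carrier_mat a a" "C1 * (X * B1) \<in> carrier_mat a a"
    by (rule carrier_matI; simp add: D1_def)+
  have "D1 * (C1 * (X * B1)) = C1 * (E * (B1 * C1) * (X * B1))" unfolding D1_def by (simp add: mult_assoc_dim)
  also have "\<dots> = C1 * (E * X * B1)" unfolding absorb(1) by (simp add: mult_assoc_dim)
  also have "\<dots> = 1\<^sub>m a" unfolding EXE(2) XE by (simp add: mult_assoc_dim)
  finally show "D1 * (C1 * (X * B1)) = 1\<^sub>m a" .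
  from mat_mult_left_right_inverse[OF D1 this] show "C1 * (X * B1) * D1 = 1\<^sub>m a" .
qed

text \<open>In each product the factors \<open>K\<close> and \<open>D2\<close> recombine to
  \<open>F * H * F = F - E\<close>; for the last one,
  \<open>R * D2 * S = C1 * (F - E) * B1\<close>.\<close>

lemma std_blocks: "C1 * (F * B2) = R * D2" "C2 * (F * B1) = D2 * S" "C1 * (F * B1) = D1 + R * D2 * S"
proof -
  show "C1 * (F * B2) = R * D2" "C2 * (F * B1) = D2 * S"
    by (simp_all add: R_def S_def D2_def pair_simps)
  show "C1 * (F * B1) = D1 + R * D2 * S"
    by (simp add: R_def S_def D1_def D2_def pair_simps) (intro eq_matI; simp del: index_mult_mat(1))
qed

text \<open>Kernel and cokernel vectors of \<open>F - E\<close>, used to test the regularity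
  condition on the difference of the dual parts.\<close>

lemma annihilate: "(F - E) * (B1 - B2 * S) = 0\<^sub>m n a" "(C1 - R * C2) * (F - E) = 0\<^sub>m a n"
  by (simp_all add: R_def S_def pair_simps) (intro eq_matI; simp del: index_mult_mat(1))

text \<open>Regularity of \<open>E\<close> and \<open>F\<close> makes the listed blocks vanish,
  since \<open>E\<close> and \<open>F\<close> vanish against the pieces of the frame there. The
  constrained (1,1), (1,3) and (3,1) blocks come from regularity of the difference, tested on the
  annihilators of \<open>F - E\<close>.\<close>

lemma dual_blocks:
  assumes E0: "E0 = E * Z1 + W1 * E" and F0: "F0 = F * Z2 + W2 * F"
    and G0: "F0 - E0 = (F - E) * Z3 + W3 * (F - E)"
    and ZW: "Z1 \<in> carrier_mat n n" "W1 \<in> carrier_mat n n" "Z2 \<in> carrier_mat n n" "W2 \<in> carrier_mat n n"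
      "Z3 \<in> carrier_mat n n" "W3 \<in> carrier_mat n n"
  defines "N \<equiv> C1 * (F0 * B2) - C1 * (E0 * B2)" and "M \<equiv> C2 * (F0 * B1) - C2 * (E0 * B1)"
  shows "C2 * (E0 * B2) = 0\<^sub>m b b" "C2 * (E0 * B3) = 0\<^sub>m b c" "C3 * (E0 * B2) = 0\<^sub>m c b"
    "C3 * (E0 * B3) = 0\<^sub>m c c" "C3 * (F0 * B3) = 0\<^sub>m c c"
    "C1 * (F0 * B1) = C1 * (E0 * B1) + R * M + N * S - R * (C2 * (F0 * B2)) * S"
    "C1 * (F0 * B2) = N + C1 * (E0 * B2)" "C2 * (F0 * B1) = M + C2 * (E0 * B1)"
    "C1 * (F0 * B3) = C1 * (E0 * B3) + R * (C2 * (F0 * B3))"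
    "C3 * (F0 * B1) = C3 * (E0 * B1) + C3 * (F0 * B2) * S"
proof -
  note d = ZW[THEN carrier_matD(1)] ZW[THEN carrier_matD(2)]
  have c0 [simp]: "dim_row E0 = n" "dim_col E0 = n" "dim_row F0 = n" "dim_col F0 = n"
    unfolding E0 F0 by (simp_all add: d)
  have RS [simp]: "dim_row R = a" "dim_col R = b" "dim_row S = b" "dim_col S = a"
    by (simp_all add: R_def S_def)
  show z: "C2 * (E0 * B2) = 0\<^sub>m b b" "C2 * (E0 * B3) = 0\<^sub>m b c" "C3 * (E0 * B2) = 0\<^sub>m c b"
    "C3 * (E0 * B3) = 0\<^sub>m c c" "C3 * (F0 * B3) = 0\<^sub>m c c"
    unfolding E0 F0 by (simp_all add: mult_assoc_dim mult_distrib_dim d)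
  show "C1 * (F0 * B2) = N + C1 * (E0 * B2)" "C2 * (F0 * B1) = M + C2 * (E0 * B1)"
    unfolding N_def M_def by (intro eq_matI; simp del: index_mult_mat(1))+
  \<comment> \<open>Each term of \<open>G0\<close> has \<open>F - E\<close> on one side, where
    either \<open>U\<close> or \<open>V\<close> kills it.\<close>
  have l: "U * ((F0 - E0) * V) = 0\<^sub>m (dim_row U) (dim_col V)"
    if "U * (F - E) = 0\<^sub>m (dim_row U) n" "(F - E) * V = 0\<^sub>m n (dim_col V)" "dim_col U = n" "dim_row V = n" for U V
    unfolding G0 using that(3,4)
    by (simp add: add_mult_dim mult_add_dim mult_assoc_dim d that(2) mult_eq_assoc_dim[OF that(1)])
  have G3: "(F - E) * B3 = 0\<^sub>m n c" "C3 * (F - E) = 0\<^sub>m c n"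
    by (simp_all add: mult_distrib_dim)
  have 11: "(C1 - R * C2) * ((F0 - E0) * (B1 - B2 * S)) = 0\<^sub>m a a"
    using l[of "C1 - R * C2" "B1 - B2 * S"] annihilate by simp
  have 13: "(C1 - R * C2) * ((F0 - E0) * B3) = 0\<^sub>m a c"
    using l[of "C1 - R * C2" B3] annihilate G3 by simp
  have 31: "C3 * ((F0 - E0) * (B1 - B2 * S)) = 0\<^sub>m c a"
    using l[of C3 "B1 - B2 * S"] annihilate G3 by simp
  note s = mult_assoc_dim mult_distrib_dim z mult_eq_assoc3_dim[OF z(1)] mult_eq_assoc3_dim[OF z(3)] N_def M_def
  \<comment> \<open>This is \<open>11\<close> expanded and solved for the (1,1) block of
    \<open>F0\<close>; the (2,2) block of \<open>E0\<close> drops out. The (1,3) and (3,1) blocks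
    follow likewise from \<open>13\<close> and \<open>31\<close>.\<close>
  show "C1 * (F0 * B1) = C1 * (E0 * B1) + R * M + N * S - R * (C2 * (F0 * B2)) * S"
  proof (rule eq_matI)
    fix i j assume "i < dim_row (C1 * (E0 * B1) + R * M + N * S - R * (C2 * (F0 * B2)) * S)"
      "j < dim_col (C1 * (E0 * B1) + R * M + N * S - R * (C2 * (F0 * B2)) * S)"
    then show "(C1 * (F0 * B1)) $$ (i,j) = (C1 * (E0 * B1) + R * M + N * S - R * (C2 * (F0 * B2)) * S) $$ (i,j)"
      using arg_cong[OF 11, of "\<lambda>X. X $$ (i,j)"] by (simp add: s del: index_mult_mat(1))
  qed simp_all
  show "C1 * (F0 * B3) = C1 * (E0 * B3) + R * (C2 * (F0 * B3))"
  proof (rule eq_matI)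
    fix i j assume "i < dim_row (C1 * (E0 * B3) + R * (C2 * (F0 * B3)))"
      "j < dim_col (C1 * (E0 * B3) + R * (C2 * (F0 * B3)))"
    then show "(C1 * (F0 * B3)) $$ (i,j) = (C1 * (E0 * B3) + R * (C2 * (F0 * B3))) $$ (i,j)"
      using arg_cong[OF 13, of "\<lambda>X. X $$ (i,j)"] by (simp add: s del: index_mult_mat(1))
  qed simp_all
  show "C3 * (F0 * B1) = C3 * (E0 * B1) + C3 * (F0 * B2) * S"
  proof (rule eq_matI)
    fix i j assume "i < dim_row (C3 * (E0 * B1) + C3 * (F0 * B2) * S)"
      "j < dim_col (C3 * (E0 * B1) + C3 * (F0 * B2) * S)"
    then show "(C3 * (F0 * B1)) $$ (i,j) = (C3 * (E0 * B1) + C3 * (F0 * B2) * S) $$ (i,j)"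
      using arg_cong[OF 31, of "\<lambda>X. X $$ (i,j)"] by (simp add: s del: index_mult_mat(1))
  qed simp_all
qed

end

section \<open>The block form\<close>

context block_frame
begin

lemma std_difference:
  assumes "D1 \<in> carrier_mat a a" "D2 \<in> carrier_mat b b" "R \<in> carrier_mat a b" "S \<in> carrier_mat b a"
  shows "blocks (D1 + R * D2 * S) (R * D2) (0\<^sub>m a c) (D2 * S) D2 (0\<^sub>m b c) (0\<^sub>m c a) (0\<^sub>m c b) (0\<^sub>m c c) -
      blocks D1 (0\<^sub>m a b) (0\<^sub>m a c) (0\<^sub>m b a) (0\<^sub>m b b) (0\<^sub>m b c) (0\<^sub>m c a) (0\<^sub>m c b) (0\<^sub>m c c) =
    (B1 * R + B2) * (D2 * (S * C1 + C2))"
proof -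
  note d [simp] = assms[THEN carrier_matD(1)] assms[THEN carrier_matD(2)]
  show ?thesis unfolding block_sum_def
    by (simp add: mult_assoc_dim mult_distrib_dim) (intro eq_matI; simp del: index_mult_mat(1))
qed

text \<open>The grouping uses the outer factors \<open>B1 * R + B2\<close> and
  \<open>S * C1 + C2\<close> of \<open>std_difference\<close>, which is the shape needed for
  regularity. The correction \<open>- R * F5\<close> offsets the contribution of
  \<open>R * F5\<close> to the (1,2) block.\<close>

lemma dual_difference:
  assumes "E1 \<in> carrier_mat a a" "E2 \<in> carrier_mat a b" "E3 \<in> carrier_mat a c"
    "E4 \<in> carrier_mat b a" "E7 \<in> carrier_mat c a"
    "F5 \<in> carrier_mat b b" "F6 \<in> carrier_mat b c" "F8 \<in> carrier_mat c b"
    "M \<in> carrier_mat b a" "N \<in> carrier_mat a b" "R \<in> carrier_mat a b" "S \<in> carrier_mat b a"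
  shows "blocks (E1 + R * M + N * S - R * F5 * S) (N + E2) (E3 + R * F6) (M + E4) F5 F6
        (E7 + F8 * S) F8 (0\<^sub>m c c) -
      blocks E1 E2 E3 E4 (0\<^sub>m b b) (0\<^sub>m b c) E7 (0\<^sub>m c b) (0\<^sub>m c c) =
    (B1 * R + B2) * (M * C1 + (F5 * C2 + F6 * C3)) + (B1 * (N - R * F5) + B3 * F8) * (S * C1 + C2)"
proof -
  note d [simp] = assms[THEN carrier_matD(1)] assms[THEN carrier_matD(2)]
  show ?thesis unfolding block_sum_def
    by (simp add: mult_assoc_dim mult_distrib_dim) (intro eq_matI; simp del: index_mult_mat(1))
qed

text \<open>The outer factors of \<open>G\<close> have the one-sided inverses \<open>C2\<close> and
  \<open>B2\<close>, so the rank is the size of \<open>D2\<close>. They are also recovered from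
  \<open>G\<close> as \<open>G * (B2 * K)\<close> and \<open>K * (C2 * G)\<close>, which puts the
  dual part in the form \<open>G * Z + W * G\<close>.\<close>

lemma difference_factors:
  assumes c: "D2 \<in> carrier_mat b b" "K \<in> carrier_mat b b" "R \<in> carrier_mat a b" "S \<in> carrier_mat b a"
      "U' \<in> carrier_mat b n" "V' \<in> carrier_mat n b"
    and K: "D2 * K = 1\<^sub>m b" "K * D2 = 1\<^sub>m b"
  defines "G \<equiv> (B1 * R + B2) * (D2 * (S * C1 + C2))"
  shows "mat_rank G = b"
    "has_dmpgi (dual_mat G ((B1 * R + B2) * U' + V' * (S * C1 + C2)))"
proof -
  note d [simp] = c[THEN carrier_matD(1)] c[THEN carrier_matD(2)]
  let ?U = "B1 * R + B2" and ?V = "S * C1 + C2"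
  have CU: "C2 * ?U = 1\<^sub>m b" and VB: "?V * B2 = 1\<^sub>m b"
    by (simp_all add: mult_distrib_dim mult_assoc_dim)
  have "rank_factorization G b (?U * D2) ?V (K * C2) B2"
    unfolding rank_factorization_def
  proof (intro conjI)
    show "K * C2 * (?U * D2) = 1\<^sub>m b"
      by (simp add: mult_assoc_dim mult_eq_assoc_dim[OF CU] K)
  qed (auto simp: G_def VB mult_assoc_dim intro!: carrier_matI)
  then show "mat_rank G = b" by (rule rank_factorization_rank)
  have Ur: "?U = G * (B2 * K)"
    unfolding G_def by (simp add: mult_assoc_dim mult_eq_assoc_dim[OF VB] K)
  have Vr: "?V = K * (C2 * G)"
    unfolding G_def by (simp add: mult_eq_assoc_dim[OF CU] mult_eq_assoc_dim[OF K(2)])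
  have G: "G \<in> carrier_mat n n" by (rule carrier_matI) (simp_all add: G_def)
  have dG [simp]: "dim_row G = n" "dim_col G = n" using G by auto
  have "?U * U' = G * (B2 * (K * U'))" by (subst Ur) (simp add: mult_assoc_dim)
  moreover have "V' * ?V = V' * (K * C2) * G" by (subst Vr) (simp add: mult_assoc_dim)
  ultimately show "has_dmpgi (dual_mat G (?U * U' + V' * ?V))"
    using has_dmpgi_dual_mat[OF G, of "B2 * (K * U')" "V' * (K * C2)"] by (simp add: carrier_matI)
qed

end

section \<open>Real data extracted from dual generalized inverses\<close>

lemma dual_CM_parts:
  assumes c: "A \<in> carrier_mat n n" "A\<^sub>0 \<in> carrier_mat n n" and CM: "dual_mat A A\<^sub>0 \<in> dual_CM n"
  obtains X Z W where "X \<in> carrier_mat n n" "Z \<in> carrier_mat n n" "W \<in> carrier_mat n n"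
    "A * (X * A) = A" "X * (A * X) = X" "A * X = X * A" "A\<^sub>0 = A * Z + W * A"
proof -
  have A: "dual_mat A A\<^sub>0 \<in> carrier_mat n n" by (rule dual_mat_carrier[OF c(2)])
  obtain Xh where "is_dggi (dual_mat A A\<^sub>0) Xh" using CM by (auto simp: dual_CM_def has_dggi_def)
  then have Xh: "Xh \<in> carrier_mat n n" and eqs: "dual_mat A A\<^sub>0 * Xh * dual_mat A A\<^sub>0 = dual_mat A A\<^sub>0"
    "Xh * dual_mat A A\<^sub>0 * Xh = Xh" "dual_mat A A\<^sub>0 * Xh = Xh * dual_mat A A\<^sub>0"
    unfolding is_dggi_def carrier_matD[OF A] by blast+
  obtain X X\<^sub>0 where X: "X \<in> carrier_mat n n" "X\<^sub>0 \<in> carrier_mat n n" "Xh = dual_mat X X\<^sub>0"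
    using ex_dual_mat[OF Xh] .
  obtain Z W where ZW: "Z \<in> carrier_mat n n" "W \<in> carrier_mat n n" "A\<^sub>0 = A * Z + W * A"
    using regular_dual_mat_part[OF c Xh eqs(1)] .
  note m = dual_mat_mult[where m = n and k = n and n = n]
  have m3: "dual_mat T T\<^sub>0 * dual_mat U U\<^sub>0 * dual_mat T T\<^sub>0 =
      dual_mat (T * U * T) (T * U * T\<^sub>0 + (T * U\<^sub>0 + T\<^sub>0 * U) * T)"
    if "T \<in> carrier_mat n n" "T\<^sub>0 \<in> carrier_mat n n" "U \<in> carrier_mat n n" "U\<^sub>0 \<in> carrier_mat n n"
    for T T\<^sub>0 U U\<^sub>0
    using that by (simp add: m)
  \<comment> \<open>The standard parts of the three equations say that \<open>X\<close> is the group
    inverse of \<open>A\<close>.\<close>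
  have r: "A * X * A = A" "X * A * X = X" and com: "A * X = X * A"
    using eqs(1)[unfolded X(3) m3[OF c X(1,2)]] eqs(2)[unfolded X(3) m3[OF X(1,2) c]]
      eqs(3)[unfolded X(3) m[OF c X(1,2)] m[OF X(1,2) c]] c X(1,2)
    by (auto elim!: dual_mat_eqD(1)[rotated 4])
  have "A * (X * A) = A" "X * (A * X) = X"
    using r(1) assoc_mult_mat[OF c(1) X(1) c(1)] r(2) assoc_mult_mat[OF X(1) c(1) X(1)] by simp_all
  then show ?thesis using that X(1) ZW com by blast
qed

lemma has_dmpgi_parts:
  assumes c: "A \<in> carrier_mat n n" "A\<^sub>0 \<in> carrier_mat n n" and "has_dmpgi (dual_mat A A\<^sub>0)"
  obtains Z W where "Z \<in> carrier_mat n n" "W \<in> carrier_mat n n" "A\<^sub>0 = A * Z + W * A"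
proof -
  have A: "dual_mat A A\<^sub>0 \<in> carrier_mat n n" by (rule dual_mat_carrier[OF c(2)])
  obtain X where "is_dmpgi (dual_mat A A\<^sub>0) X" using assms(3) by (auto simp: has_dmpgi_def)
  then have "X \<in> carrier_mat n n" "dual_mat A A\<^sub>0 * X * dual_mat A A\<^sub>0 = dual_mat A A\<^sub>0"
    unfolding is_dmpgi_def carrier_matD[OF A] by blast+
  then show ?thesis using regular_dual_mat_part[OF c] that by metis
qed

lemma invertible_matI:
  assumes "A \<in> carrier_mat n n" "B \<in> carrier_mat n n" "A * B = 1\<^sub>m n" "B * A = 1\<^sub>m n"
  shows "invertible_mat A"
  using assms unfolding invertible_mat_def inverts_mat_def square_mat.simps by (metis carrier_matD)

text \<open>\<open>inverts_mat\<close> leaves the size of the inverse open; comparing the column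
  counts in the two identities fixes it.\<close>

lemma invertible_matE:
  assumes A: "A \<in> carrier_mat n n" and inv: "invertible_mat A"
  obtains B where "B \<in> carrier_mat n n" "A * B = 1\<^sub>m n" "B * A = 1\<^sub>m n"
proof -
  obtain B where AB: "A * B = 1\<^sub>m n" and BA: "B * A = 1\<^sub>m (dim_row B)"
    using A inv by (auto simp: invertible_mat_def inverts_mat_def)
  have d: "dim_row B = n" "dim_col B = n"
    using arg_cong[OF BA, of dim_col] arg_cong[OF AB, of dim_col] carrier_matD[OF A] by simp_all
  show ?thesis using that[OF carrier_matI[OF d] AB BA[unfolded d]] .
qed

lemma mat_rank_le_dim_col: "mat_rank A \<le> dim_col A"
  unfolding mat_rank_def by (rule vec_space.rank_le_nc) auto

theorem theorem3p8:
  fixes n re rf :: nat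
    and E E\<^sub>0 F F\<^sub>0 :: "real mat"
    and Ehat Fhat :: "dual mat"
  assumes "E \<in> carrier_mat n n" and "E\<^sub>0 \<in> carrier_mat n n"
    and "F \<in> carrier_mat n n" and "F\<^sub>0 \<in> carrier_mat n n"
    and "Ehat = dual_mat E E\<^sub>0" and "Fhat = dual_mat F F\<^sub>0"
    and "Ehat \<in> dual_CM n" and "Fhat \<in> dual_CM n"
    and "re = mat_rank E" and "rf = mat_rank F"
  shows "dual_minus_le Ehat Fhat \<longleftrightarrow>
    re \<le> rf \<and>
    (\<exists>P Pinv D1 D2 M N R S E1 E2 E3 E4 E7 F5 F6 F8.
       P \<in> carrier_mat n n \<and> Pinv \<in> carrier_mat n n \<and>
       inverts_mat P Pinv \<and> inverts_mat Pinv P \<and>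
       D1 \<in> carrier_mat re re \<and> invertible_mat D1 \<and>
       D2 \<in> carrier_mat (rf - re) (rf - re) \<and> invertible_mat D2 \<and>
       M \<in> carrier_mat (rf - re) re \<and> S \<in> carrier_mat (rf - re) re \<and>
       N \<in> carrier_mat re (rf - re) \<and> R \<in> carrier_mat re (rf - re) \<and>
       E1 \<in> carrier_mat re re \<and>
       E2 \<in> carrier_mat re (rf - re) \<and>
       E3 \<in> carrier_mat re (n - rf) \<and>
       E4 \<in> carrier_mat (rf - re) re \<and>
       E7 \<in> carrier_mat (n - rf) re \<and>
       F5 \<in> carrier_mat (rf - re) (rf - re) \<and>
       F6 \<in> carrier_mat (rf - re) (n - rf) \<and>
       F8 \<in> carrier_mat (n - rf) (rf - re) \<and>
       Ehat = dual_mat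
         (P * block3
            D1                         (0\<^sub>m re (rf - re))           (0\<^sub>m re (n - rf))
            (0\<^sub>m (rf - re) re)         (0\<^sub>m (rf - re) (rf - re))    (0\<^sub>m (rf - re) (n - rf))
            (0\<^sub>m (n - rf) re)          (0\<^sub>m (n - rf) (rf - re))     (0\<^sub>m (n - rf) (n - rf))
          * Pinv)
         (P * block3
            E1                         E2                           E3
            E4                         (0\<^sub>m (rf - re) (rf - re))    (0\<^sub>m (rf - re) (n - rf))
            E7                         (0\<^sub>m (n - rf) (rf - re))     (0\<^sub>m (n - rf) (n - rf))
          * Pinv) \<and>
       Fhat = dual_mat
         (P * block3
            (D1 + R * D2 * S)          (R * D2)                     (0\<^sub>m re (n - rf))
            (D2 * S)                   D2                           (0\<^sub>m (rf - re) (n - rf))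
            (0\<^sub>m (n - rf) re)          (0\<^sub>m (n - rf) (rf - re))     (0\<^sub>m (n - rf) (n - rf))
          * Pinv)
         (P * block3
            (E1 + R * M + N * S - R * F5 * S)  (N + E2)             (E3 + R * F6)
            (M + E4)                   F5                           F6
            (E7 + F8 * S)              F8                           (0\<^sub>m (n - rf) (n - rf))
          * Pinv))"
  (is "_ \<longleftrightarrow> ?B")
proof
  note EF_carrier = assms(1-4)
  \<comment> \<open>The index-one hypotheses serve both directions: the group inverses build the
    frame, and the regular dual parts give the Moore-Penrose inverses of \<open>Ehat\<close> and
    \<open>Fhat\<close>.\<close>
  obtain X Z1 W1 where X: "X \<in> carrier_mat n n" "Z1 \<in> carrier_mat n n" "W1 \<in> carrier_mat n n"
    "E * (X * E) = E" "X * (E * X) = X" "E * X = X * E" "E\<^sub>0 = E * Z1 + W1 * E"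
    using dual_CM_parts[OF EF_carrier(1,2) assms(7)[unfolded assms(5)]] .
  obtain Y Z2 W2 where Y: "Y \<in> carrier_mat n n" "Z2 \<in> carrier_mat n n" "W2 \<in> carrier_mat n n"
    "F * (Y * F) = F" "Y * (F * Y) = Y" "F * Y = Y * F" "F\<^sub>0 = F * Z2 + W2 * F"
    using dual_CM_parts[OF EF_carrier(3,4) assms(8)[unfolded assms(6)]] .
  have std: "std_mat Ehat = E" "std_mat Fhat = F"
    unfolding assms(5,6) by (rule std_mat_dual_mat[OF EF_carrier(1,2)], rule std_mat_dual_mat[OF EF_carrier(3,4)])
  have diff: "Fhat - Ehat = dual_mat (F - E) (F\<^sub>0 - E\<^sub>0)"
    unfolding assms(5,6) by (rule dual_mat_minus[OF EF_carrier(3,4,1,2)])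
  have dc: "Ehat \<in> carrier_mat n n" "Fhat \<in> carrier_mat n n"
    unfolding assms(5,6) by (rule dual_mat_carrier[OF EF_carrier(2)], rule dual_mat_carrier[OF EF_carrier(4)])
  {
    assume le: "dual_minus_le Ehat Fhat"
    then have ml: "minus_le E F" and G: "has_dmpgi (dual_mat (F - E) (F\<^sub>0 - E\<^sub>0))"
      unfolding dual_minus_le_def std diff by blast+
    have Gc: "F - E \<in> carrier_mat n n" "F\<^sub>0 - E\<^sub>0 \<in> carrier_mat n n" using EF_carrier by auto
    obtain Z3 W3 where Z3: "Z3 \<in> carrier_mat n n" "W3 \<in> carrier_mat n n"
      "F\<^sub>0 - E\<^sub>0 = (F - E) * Z3 + W3 * (F - E)"
      using has_dmpgi_parts[OF Gc G] .
    note EF = minus_le_ginv[OF EF_carrier(1,3) Y(1,4) ml]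
    obtain B1 B2 B3 C1 C2 C3 where fr: "block_frame n re (rf - re) (n - rf) B1 B2 B3 C1 C2 C3"
      and le: "re \<le> rf" and pr: "X * E = B1 * C1" "Y * F = B1 * C1 + B2 * C2"
      unfolding assms(9,10)
      using ex_block_frame[OF EF_carrier(1,3) X(1) Y(1) X(4,6) Y(4,6) EF(2,3)] .
    interpret minus_pair n re "rf - re" "n - rf" B1 B2 B3 C1 C2 C3 E F X Y
      using fr by (rule minus_pair.intro) (unfold_locales; fact EF_carrier X Y EF pr)
    define P Pinv where "P = append_cols B1 (append_cols B2 B3)" and "Pinv = C1 @\<^sub>r (C2 @\<^sub>r C3)"
    \<comment> \<open>Natural subtraction truncates, so both bounds are needed for the block sizes
      to add up to \<open>n\<close>.\<close>
    have rfn: "rf \<le> n" using mat_rank_le_dim_col[of F] EF_carrier assms(10) by simp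
    have n: "re + (rf - re + (n - rf)) = n" using le rfn by simp
    have Pc: "P \<in> carrier_mat n n" "Pinv \<in> carrier_mat n n"
      by (rule carrier_matI; simp add: P_def Pinv_def n)+
    have PP: "P * Pinv = 1\<^sub>m n" unfolding P_def Pinv_def
      by (simp add: append_cols_mult_append_rows BC)
    have PP': "Pinv * P = 1\<^sub>m n" by (rule mat_mult_left_right_inverse[OF Pc PP])
    have conj: "P * block3 A11 A12 A13 A21 A22 A23 A31 A32 A33 * Pinv =
        blocks A11 A12 A13 A21 A22 A23 A31 A32 A33"
      if "A11 \<in> carrier_mat re re" "A12 \<in> carrier_mat re (rf - re)" "A13 \<in> carrier_mat re (n - rf)"
        "A21 \<in> carrier_mat (rf - re) re" "A22 \<in> carrier_mat (rf - re) (rf - re)" "A23 \<in> carrier_mat (rf - re) (n - rf)"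
        "A31 \<in> carrier_mat (n - rf) re" "A32 \<in> carrier_mat (n - rf) (rf - re)" "A33 \<in> carrier_mat (n - rf) (n - rf)"
      for A11 A12 A13 A21 A22 A23 A31 A32 A33
      unfolding P_def Pinv_def by (rule block3_conj[OF carriers that])
    \<comment> \<open>These values are forced by the entries \<open>N + E2\<close> and
      \<open>M + E4\<close> of the dual part of \<open>Fhat\<close>.\<close>
    define N M where "N = C1 * (F\<^sub>0 * B2) - C1 * (E\<^sub>0 * B2)" and "M = C2 * (F\<^sub>0 * B1) - C2 * (E\<^sub>0 * B1)"
    note db = dual_blocks[OF X(7) Y(7) Z3(3) X(2,3) Y(2,3) Z3(1,2), folded N_def M_def]
    have d0 [simp]: "dim_row E\<^sub>0 = n" "dim_col E\<^sub>0 = n" "dim_row F\<^sub>0 = n" "dim_col F\<^sub>0 = n"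
      using EF_carrier by auto
    have bc: "D1 \<in> carrier_mat re re" "D2 \<in> carrier_mat (rf - re) (rf - re)"
      "M \<in> carrier_mat (rf - re) re" "S \<in> carrier_mat (rf - re) re"
      "N \<in> carrier_mat re (rf - re)" "R \<in> carrier_mat re (rf - re)"
      "C1 * (E\<^sub>0 * B1) \<in> carrier_mat re re" "C1 * (E\<^sub>0 * B2) \<in> carrier_mat re (rf - re)"
      "C1 * (E\<^sub>0 * B3) \<in> carrier_mat re (n - rf)"
      "C2 * (E\<^sub>0 * B1) \<in> carrier_mat (rf - re) re" "C3 * (E\<^sub>0 * B1) \<in> carrier_mat (n - rf) re"
      "C2 * (F\<^sub>0 * B2) \<in> carrier_mat (rf - re) (rf - re)"
      "C2 * (F\<^sub>0 * B3) \<in> carrier_mat (rf - re) (n - rf)"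
      "C3 * (F\<^sub>0 * B2) \<in> carrier_mat (n - rf) (rf - re)"
      by (rule carrier_matI; simp add: D1_def D2_def M_def N_def R_def S_def)+
    have Cinv: "C1 * (X * B1) \<in> carrier_mat re re" by (rule carrier_matI; simp)
    note dbc [simp] = bc[THEN carrier_matD(1)] bc[THEN carrier_matD(2)]
    have inv: "invertible_mat D1" "invertible_mat D2"
      by (rule invertible_matI[OF bc(1) Cinv D1_inverse], rule invertible_matI[OF bc(2) K(2) D2_inverse])
    have Eb: "E = blocks D1 (0\<^sub>m re (rf - re)) (0\<^sub>m re (n - rf))
        (0\<^sub>m (rf - re) re) (0\<^sub>m (rf - re) (rf - re)) (0\<^sub>m (rf - re) (n - rf))
        (0\<^sub>m (n - rf) re) (0\<^sub>m (n - rf) (rf - re)) (0\<^sub>m (n - rf) (n - rf))"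
      by (subst blocks_eq[OF EF_carrier(1)]) (simp add: mult_assoc_dim D1_def)
    have E0b: "E\<^sub>0 = blocks (C1 * (E\<^sub>0 * B1)) (C1 * (E\<^sub>0 * B2)) (C1 * (E\<^sub>0 * B3))
        (C2 * (E\<^sub>0 * B1)) (0\<^sub>m (rf - re) (rf - re)) (0\<^sub>m (rf - re) (n - rf))
        (C3 * (E\<^sub>0 * B1)) (0\<^sub>m (n - rf) (rf - re)) (0\<^sub>m (n - rf) (n - rf))"
      by (subst blocks_eq[OF EF_carrier(2)]) (simp add: mult_assoc_dim db(1-4))
    have Fb: "F = blocks (D1 + R * D2 * S) (R * D2) (0\<^sub>m re (n - rf))
        (D2 * S) D2 (0\<^sub>m (rf - re) (n - rf))
        (0\<^sub>m (n - rf) re) (0\<^sub>m (n - rf) (rf - re)) (0\<^sub>m (n - rf) (n - rf))"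
      by (subst blocks_eq[OF EF_carrier(3)]) (simp add: mult_assoc_dim std_blocks D2_def[symmetric])
    have F0b: "F\<^sub>0 = blocks (C1 * (E\<^sub>0 * B1) + R * M + N * S - R * (C2 * (F\<^sub>0 * B2)) * S)
        (N + C1 * (E\<^sub>0 * B2)) (C1 * (E\<^sub>0 * B3) + R * (C2 * (F\<^sub>0 * B3)))
        (M + C2 * (E\<^sub>0 * B1)) (C2 * (F\<^sub>0 * B2)) (C2 * (F\<^sub>0 * B3))
        (C3 * (E\<^sub>0 * B1) + C3 * (F\<^sub>0 * B2) * S) (C3 * (F\<^sub>0 * B2)) (0\<^sub>m (n - rf) (n - rf))"
      unfolding db(6-10)[symmetric]
      by (subst blocks_eq[OF EF_carrier(4)]) (simp add: mult_assoc_dim db(5))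
    \<comment> \<open>The remaining witnesses are the corresponding blocks of
      \<open>E\<^sub>0\<close> and \<open>F\<^sub>0\<close> in the frame.\<close>
    show ?B
    proof (rule conjI[OF le], rule exI[of _ P], rule exI[of _ Pinv], rule exI[of _ D1], rule exI[of _ D2],
        rule exI[of _ M], rule exI[of _ N], rule exI[of _ R], rule exI[of _ S],
        rule exI[of _ "C1 * (E\<^sub>0 * B1)"], rule exI[of _ "C1 * (E\<^sub>0 * B2)"], rule exI[of _ "C1 * (E\<^sub>0 * B3)"],
        rule exI[of _ "C2 * (E\<^sub>0 * B1)"], rule exI[of _ "C3 * (E\<^sub>0 * B1)"],
        rule exI[of _ "C2 * (F\<^sub>0 * B2)"], rule exI[of _ "C2 * (F\<^sub>0 * B3)"], rule exI[of _ "C3 * (F\<^sub>0 * B2)"],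
        intro conjI)
      show "inverts_mat P Pinv" "inverts_mat Pinv P"
        unfolding inverts_mat_def using PP PP' Pc by auto
    next
      show "Ehat = dual_mat
         (P * block3 D1 (0\<^sub>m re (rf - re)) (0\<^sub>m re (n - rf))
            (0\<^sub>m (rf - re) re) (0\<^sub>m (rf - re) (rf - re)) (0\<^sub>m (rf - re) (n - rf))
            (0\<^sub>m (n - rf) re) (0\<^sub>m (n - rf) (rf - re)) (0\<^sub>m (n - rf) (n - rf)) * Pinv)
         (P * block3 (C1 * (E\<^sub>0 * B1)) (C1 * (E\<^sub>0 * B2)) (C1 * (E\<^sub>0 * B3))
            (C2 * (E\<^sub>0 * B1)) (0\<^sub>m (rf - re) (rf - re)) (0\<^sub>m (rf - re) (n - rf))
            (C3 * (E\<^sub>0 * B1)) (0\<^sub>m (n - rf) (rf - re)) (0\<^sub>m (n - rf) (n - rf)) * Pinv)"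
        unfolding assms(5)
        by (rule arg_cong2[of _ _ _ _ dual_mat]; subst conj, (rule bc zero_carrier_mat)+)
          (fact Eb E0b)+
    next
      show "Fhat = dual_mat
         (P * block3 (D1 + R * D2 * S) (R * D2) (0\<^sub>m re (n - rf))
            (D2 * S) D2 (0\<^sub>m (rf - re) (n - rf))
            (0\<^sub>m (n - rf) re) (0\<^sub>m (n - rf) (rf - re)) (0\<^sub>m (n - rf) (n - rf)) * Pinv)
         (P * block3 (C1 * (E\<^sub>0 * B1) + R * M + N * S - R * (C2 * (F\<^sub>0 * B2)) * S)
            (N + C1 * (E\<^sub>0 * B2)) (C1 * (E\<^sub>0 * B3) + R * (C2 * (F\<^sub>0 * B3)))
            (M + C2 * (E\<^sub>0 * B1)) (C2 * (F\<^sub>0 * B2)) (C2 * (F\<^sub>0 * B3))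
            (C3 * (E\<^sub>0 * B1) + C3 * (F\<^sub>0 * B2) * S) (C3 * (F\<^sub>0 * B2)) (0\<^sub>m (n - rf) (n - rf)) * Pinv)"
        unfolding assms(6)
        by (rule arg_cong2[of _ _ _ _ dual_mat]; subst conj,
            (rule bc zero_carrier_mat add_carrier_mat minus_carrier_mat mult_carrier_mat)+)
          (fact Fb F0b)+
    qed (fact Pc bc inv)+
  }
  {
    assume ?B
    then obtain P Pinv D1 D2 M N R S E1 E2 E3 E4 E7 F5 F6 F8 where le: "re \<le> rf"
      and Pc: "P \<in> carrier_mat n n" "Pinv \<in> carrier_mat n n"
      and PP: "inverts_mat P Pinv" "inverts_mat Pinv P"
      and D1: "D1 \<in> carrier_mat re re"
      and D2: "D2 \<in> carrier_mat (rf - re) (rf - re)" "invertible_mat D2"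
      and MS: "M \<in> carrier_mat (rf - re) re" "N \<in> carrier_mat re (rf - re)"
        "R \<in> carrier_mat re (rf - re)" "S \<in> carrier_mat (rf - re) re"
      and bl: "E1 \<in> carrier_mat re re" "E2 \<in> carrier_mat re (rf - re)" "E3 \<in> carrier_mat re (n - rf)"
       "E4 \<in> carrier_mat (rf - re) re" "E7 \<in> carrier_mat (n - rf) re"
       "F5 \<in> carrier_mat (rf - re) (rf - re)" "F6 \<in> carrier_mat (rf - re) (n - rf)"
       "F8 \<in> carrier_mat (n - rf) (rf - re)"
      and Eh: "Ehat = dual_mat
         (P * block3 D1 (0\<^sub>m re (rf - re)) (0\<^sub>m re (n - rf))
            (0\<^sub>m (rf - re) re) (0\<^sub>m (rf - re) (rf - re)) (0\<^sub>m (rf - re) (n - rf))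
            (0\<^sub>m (n - rf) re) (0\<^sub>m (n - rf) (rf - re)) (0\<^sub>m (n - rf) (n - rf)) * Pinv)
         (P * block3 E1 E2 E3 E4 (0\<^sub>m (rf - re) (rf - re)) (0\<^sub>m (rf - re) (n - rf))
            E7 (0\<^sub>m (n - rf) (rf - re)) (0\<^sub>m (n - rf) (n - rf)) * Pinv)"
      and Fh: "Fhat = dual_mat
         (P * block3 (D1 + R * D2 * S) (R * D2) (0\<^sub>m re (n - rf))
            (D2 * S) D2 (0\<^sub>m (rf - re) (n - rf))
            (0\<^sub>m (n - rf) re) (0\<^sub>m (n - rf) (rf - re)) (0\<^sub>m (n - rf) (n - rf)) * Pinv)
         (P * block3 (E1 + R * M + N * S - R * F5 * S) (N + E2) (E3 + R * F6)
            (M + E4) F5 F6 (E7 + F8 * S) F8 (0\<^sub>m (n - rf) (n - rf)) * Pinv)"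
      by (elim conjE exE) (rule that; assumption)
    have rfn: "rf \<le> n" using mat_rank_le_dim_col[of F] EF_carrier assms(10) by simp
    have n: "n = re + (rf - re + (n - rf))" using le rfn by simp
    have Pc': "P \<in> carrier_mat n (re + (rf - re + (n - rf)))" "Pinv \<in> carrier_mat (re + (rf - re + (n - rf))) n"
      using Pc n by simp_all
    obtain B1 B2 B3 where B: "B1 \<in> carrier_mat n re" "B2 \<in> carrier_mat n (rf - re)" "B3 \<in> carrier_mat n (n - rf)"
      and P: "P = append_cols B1 (append_cols B2 B3)"
      using split_cols3[OF Pc'(1)] .
    obtain C1 C2 C3 where C: "C1 \<in> carrier_mat re n" "C2 \<in> carrier_mat (rf - re) n" "C3 \<in> carrier_mat (n - rf) n"
      and Pinv: "Pinv = C1 @\<^sub>r (C2 @\<^sub>r C3)"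
      using split_rows3[OF Pc'(2)] .
    \<comment> \<open>The given \<open>P\<close> and its inverse, cut into blocks, supply all
      relations of a frame.\<close>
    have "Pinv * P = 1\<^sub>m (re + (rf - re + (n - rf)))"
      using PP(2) Pc(2) n unfolding inverts_mat_def by simp
    note CB = this[unfolded P Pinv inverse_blocks_iff[OF B C]]
    have BC: "B1 * C1 + (B2 * C2 + B3 * C3) = 1\<^sub>m n"
      using PP(1) Pc B C unfolding inverts_mat_def P Pinv by (simp add: append_cols_mult_append_rows)
    interpret block_frame n re "rf - re" "n - rf" B1 B2 B3 C1 C2 C3
      by unfold_locales (use B C CB BC in blast)+
    note conj = block3_conj[OF B C, folded P Pinv]
    obtain K where K: "K \<in> carrier_mat (rf - re) (rf - re)" "D2 * K = 1\<^sub>m (rf - re)" "K * D2 = 1\<^sub>m (rf - re)"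
      using invertible_matE[OF D2] .
    let ?G = "(B1 * R + B2) * (D2 * (S * C1 + C2))"
    let ?U = "M * C1 + (F5 * C2 + F6 * C3)" and ?V = "B1 * (N - R * F5) + B3 * F8"
    let ?H = "(B1 * R + B2) * ?U + ?V * (S * C1 + C2)"
    have blc: "blocks A11 A12 A13 A21 A22 A23 A31 A32 A33 \<in> carrier_mat n n"
      for A11 A12 A13 A21 A22 A23 A31 A32 A33
      by (rule carrier_matI) (simp_all add: block_sum_def)
    have cs: "D1 + R * D2 * S \<in> carrier_mat re re" "R * D2 \<in> carrier_mat re (rf - re)"
      "D2 * S \<in> carrier_mat (rf - re) re" "E1 + R * M + N * S - R * F5 * S \<in> carrier_mat re re"
      "N + E2 \<in> carrier_mat re (rf - re)" "E3 + R * F6 \<in> carrier_mat re (n - rf)"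
      "M + E4 \<in> carrier_mat (rf - re) re" "E7 + F8 * S \<in> carrier_mat (n - rf) re"
      using D1 D2 MS bl by auto
    have Eb: "dual_mat E E\<^sub>0 = dual_mat
      (blocks D1 (0\<^sub>m re (rf - re)) (0\<^sub>m re (n - rf))
         (0\<^sub>m (rf - re) re) (0\<^sub>m (rf - re) (rf - re)) (0\<^sub>m (rf - re) (n - rf))
         (0\<^sub>m (n - rf) re) (0\<^sub>m (n - rf) (rf - re)) (0\<^sub>m (n - rf) (n - rf)))
      (blocks E1 E2 E3 E4 (0\<^sub>m (rf - re) (rf - re)) (0\<^sub>m (rf - re) (n - rf))
         E7 (0\<^sub>m (n - rf) (rf - re)) (0\<^sub>m (n - rf) (n - rf)))"
      using Eh by (simp only: assms(5) conj D1 bl zero_carrier_mat)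
    have Fb: "dual_mat F F\<^sub>0 = dual_mat
      (blocks (D1 + R * D2 * S) (R * D2) (0\<^sub>m re (n - rf))
         (D2 * S) D2 (0\<^sub>m (rf - re) (n - rf))
         (0\<^sub>m (n - rf) re) (0\<^sub>m (n - rf) (rf - re)) (0\<^sub>m (n - rf) (n - rf)))
      (blocks (E1 + R * M + N * S - R * F5 * S) (N + E2) (E3 + R * F6)
         (M + E4) F5 F6 (E7 + F8 * S) F8 (0\<^sub>m (n - rf) (n - rf)))"
      using Fh by (simp only: assms(6) conj cs D2(1) bl zero_carrier_mat)
    note Ee = dual_mat_eqD[OF EF_carrier(1,2) blc blc Eb]
    note Fe = dual_mat_eqD[OF EF_carrier(3,4) blc blc Fb]
    have G: "F - E = ?G" "F\<^sub>0 - E\<^sub>0 = ?H"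
      unfolding Ee Fe
      by (rule std_difference[OF D1 D2(1) MS(3,4)], rule dual_difference[OF bl MS(1,2,3,4)])
    have Uc: "?U \<in> carrier_mat (rf - re) n" "?V \<in> carrier_mat n (rf - re)"
      by (rule carrier_matI; use MS bl in simp)+
    note df = difference_factors[OF D2(1) K(1) MS(3,4) Uc K(2,3), folded G]
    \<comment> \<open>By \<open>df(1)\<close> the rank of \<open>F - E\<close> is
      \<open>rf - re\<close>; \<open>re \<le> rf\<close> matches this with the integer difference in
      \<open>minus_le\<close>.\<close>
    have "minus_le E F"
      unfolding minus_le_def df(1) using EF_carrier le assms(9,10) by auto
    moreover have "has_dmpgi Ehat" "has_dmpgi Fhat"
      unfolding assms(5,6) X(7) Y(7)
      by (rule has_dmpgi_dual_mat; fact EF_carrier X Y)+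
    ultimately show "dual_minus_le Ehat Fhat"
      unfolding dual_minus_le_def std diff using df(2) dc by auto
  }
qed

end
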